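(* The structures of $\mathrm{P}$-numbers, of $\mathrm{SP}$-numbers, and of $\mathcal{E}_n$-numbers for each $n\ge2$ do not have computable copies. That is, if $R\subseteq\mathbb{R}$ is the set of all $\mathrm{P}$-numbers, or the set of all $\mathrm{SP}$-numbers, or the set of all $\mathcal{E}_n$-numbers for some $n\ge2$, then the structure $(R,0,Q^3_+,Q^3_-)$, where $Q^3_+(x,y,z)\leftrightarrow x+y\le z$ and $Q^3_-(x,y,z)\leftrightarrow x+y\ge z$, has no computable copy.
   Context: For a total $f:\omega\to\{0,1,2\}$ put $\overline f=\sum_{i=0}^\infty\frac{f(i)-1}{2^{i+1}}$. For a class $C$ of total computable functions let $\widetilde C=\{m+\overline f\mid m\in\mathbb{Z},\ f\in C \text{ unary},\ \mathrm{im}(f)\subseteq\{0,1,2\}\}$. The $\mathrm{P}$-numbers (polynomial time computable reals) are the elements of $\widetilde{C}$ where $C$ is the class of functions whose value is computable in time polynomial in the argument itself (not its length); i.e. the digit $f(i)$ is computed in time polynomial in $i$. The $\mathrm{SP}$-numbers are the elements of $\widetilde C$ where $C=\mathrm{P}$ is the class of functions computable in time polynomial in the (binary) length of the argument; i.e. the digit $f(i)$ is computed in time polynomial in the length of $i$. For $n\ge3$, the $\mathcal{E}_n$-numbers are the elements of $\widetilde{\mathcal{E}_n}$, where $\mathcal{E}_n$ is the $n$-th Grzegorczyk class (standard indexing: $\mathcal{E}_2$ contains multiplication but not $\lambda x.2^x$, and $\mathcal{E}_3$ is the class of Kalmár elementary functions). For $n=2$, the $\mathcal{E}_2$-numbers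 are the elements of $\widetilde C$ where $C=\mathrm{DSpace}(n)$ is the class of functions computable in space linear in the argument; i.e. the digit $f(i)$ is computed in space $O(i)$. A computable copy of a structure with universe $A$ is a surjection $\nu:\omega\to A$ with respect to which all relations and operations of the signature, including equality, are computable. *)

theory Defs
  imports
    "HOL-Analysis.Analysis"
    "HOL-Computational_Algebra.Polynomial"
    "HOL-Library.Log_Nat"
begin

section \<open>Recursive functions\<close>

text \<open>A function of arity \<open>k\<close> is an HOL function on lists; only its values on lists of
  length \<open>k\<close> matter, see the rules named \<open>ext\<close>.\<close>

fun prim_rec :: "(nat list \<Rightarrow> nat) \<Rightarrow> (nat list \<Rightarrow> nat) \<Rightarrow> nat list \<Rightarrow> nat" where
  "prim_rec g h [] = 0"
| "prim_rec g h (0 # xs) = g xs"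
| "prim_rec g h (Suc n # xs) = h (n # prim_rec g h (n # xs) # xs)"

text \<open>The total recursive functions: minimization is applied to regular functions only.\<close>

inductive recursive :: "nat \<Rightarrow> (nat list \<Rightarrow> nat) \<Rightarrow> bool" where
  zero: "recursive k (\<lambda>xs. 0)"
| succ: "recursive 1 (\<lambda>xs. Suc (xs ! 0))"
| proj: "i < k \<Longrightarrow> recursive k (\<lambda>xs. xs ! i)"
| comp: "recursive (length fs) g \<Longrightarrow> \<forall>f\<in>set fs. recursive k f \<Longrightarrow>
    recursive k (\<lambda>xs. g (map (\<lambda>f. f xs) fs))"
| prec: "recursive k g \<Longrightarrow> recursive (k + 2) h \<Longrightarrow> recursive (k + 1) (prim_rec g h)"
| minim: "recursive (k + 1) f \<Longrightarrow> \<forall>xs. length xs = k \<longrightarrow> (\<exists>y. f (y # xs) = 0) \<Longrightarrow>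
    recursive k (\<lambda>xs. LEAST y. f (y # xs) = 0)"
| ext: "recursive k f \<Longrightarrow> \<forall>xs. length xs = k \<longrightarrow> g xs = f xs \<Longrightarrow> recursive k g"

definition decidable :: "nat \<Rightarrow> (nat list \<Rightarrow> bool) \<Rightarrow> bool" where
  "decidable k P \<longleftrightarrow> recursive k (\<lambda>xs. of_bool (P xs))"

section \<open>Structures and computable copies\<close>

text \<open>Operations and relations carry their arity; constants are operations of arity 0.\<close>

record 'a struct =
  universe :: "'a set"
  operations :: "(nat \<times> ('a list \<Rightarrow> 'a)) list"
  relations :: "(nat \<times> ('a list \<Rightarrow> bool)) list"

definition computable_copy :: "'a struct \<Rightarrow> (nat \<Rightarrow> 'a) \<Rightarrow> bool" where
  "computable_copy A \<nu> \<longleftrightarrow>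
     range \<nu> = universe A \<and>
     decidable 2 (\<lambda>xs. \<nu> (xs ! 0) = \<nu> (xs ! 1)) \<and>
     (\<forall>(k, f)\<in>set (operations A).
        \<exists>F. recursive k F \<and> (\<forall>xs. length xs = k \<longrightarrow> \<nu> (F xs) = f (map \<nu> xs))) \<and>
     (\<forall>(k, P)\<in>set (relations A). decidable k (\<lambda>xs. P (map \<nu> xs)))"

definition has_computable_copy :: "'a struct \<Rightarrow> bool" where
  "has_computable_copy A \<longleftrightarrow> (\<exists>\<nu>. computable_copy A \<nu>)"

definition Q_plus :: "real list \<Rightarrow> bool" where
  "Q_plus xs \<longleftrightarrow> xs ! 0 + xs ! 1 \<le> xs ! 2"

definition Q_minus :: "real list \<Rightarrow> bool" where
  "Q_minus xs \<longleftrightarrow> xs ! 0 + xs ! 1 \<ge> xs ! 2"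

definition real_struct :: "real set \<Rightarrow> real struct" where
  "real_struct R =
     \<lparr>universe = R, operations = [(0, \<lambda>_. 0)], relations = [(3, Q_plus), (3, Q_minus)]\<rparr>"

section \<open>Multitape Turing machines\<close>

text \<open>The tapes are infinite in both directions. Symbol 0 is the blank, and 1 and 2 stand for
  the bits 0 and 1. The machine starts in state 0 and halts on reaching state \<open>states M\<close>.
  The transition function maps a state and the scanned symbols to the new state and, for each
  tape, the symbol to write and the head movement.\<close>

record tm =
  tapes :: nat
  states :: nat
  symbols :: nat
  delta :: "nat \<Rightarrow> nat list \<Rightarrow> nat \<times> (nat \<times> int) list"

definition wf_tm :: "tm \<Rightarrow> bool" where
  "wf_tm M \<longleftrightarrow> 2 \<le> tapes M \<and> 3 \<le> symbols M \<and>
     (\<forall>q<states M. \<forall>xs. length xs = tapes M \<and> set xs \<subseteq> {..<symbols M} \<longrightarrow>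
        (case delta M q xs of (q', as) \<Rightarrow>
           q' \<le> states M \<and> length as = tapes M \<and> set as \<subseteq> {..<symbols M} \<times> {-1, 0, 1}))"

text \<open>A tape is given by the head position and the contents of its cells.\<close>

type_synonym tape = "int \<times> (int \<Rightarrow> nat)"
type_synonym config = "nat \<times> tape list"

fun act :: "tape \<Rightarrow> nat \<times> int \<Rightarrow> tape" where
  "act (p, t) (s, d) = (p + d, t(p := s))"

definition step :: "tm \<Rightarrow> config \<Rightarrow> config" where
  "step M c = (case c of (q, ts) \<Rightarrow>
     if q < states M then
       (case delta M q (map (\<lambda>(p, t). t p) ts) of (q', as) \<Rightarrow> (q', map2 act ts as))
     else c)"

text \<open>Natural numbers are written in binary, least significant bit in cell 0;
  \<open>floorlog 2 n\<close> is the length of \<open>n\<close>.\<close>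

definition enc :: "nat \<Rightarrow> int \<Rightarrow> nat" where
  "enc n j = (if 0 \<le> j \<and> j < int (floorlog 2 n) then if bit n (nat j) then 2 else 1 else 0)"

definition init :: "tm \<Rightarrow> nat \<Rightarrow> config" where
  "init M n = (0, (0, enc n) # replicate (tapes M - 1) (0, \<lambda>_. 0))"

definition run :: "tm \<Rightarrow> nat \<Rightarrow> nat \<Rightarrow> config" where
  "run M n t = (step M ^^ t) (init M n)"

text \<open>On input \<open>n\<close>, the machine has halted after at most \<open>t\<close> steps with the output \<open>m\<close>
  on its second tape.\<close>

definition outputs_within :: "tm \<Rightarrow> nat \<Rightarrow> nat \<Rightarrow> nat \<Rightarrow> bool" where
  "outputs_within M n t m \<longleftrightarrow>
     (case run M n t of (q, ts) \<Rightarrow> q = states M \<and> snd (ts ! 1) = enc m)"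

text \<open>The total number of cells visited during the first \<open>t\<close> steps.\<close>

definition space_used :: "tm \<Rightarrow> nat \<Rightarrow> nat \<Rightarrow> nat" where
  "space_used M n t = (\<Sum>j<tapes M. card ((\<lambda>s. fst (snd (run M n s) ! j)) ` {..t}))"

definition poly_time_in_argument :: "(nat \<Rightarrow> nat) set" where
  "poly_time_in_argument =
     {f. \<exists>M (p :: nat poly). wf_tm M \<and> (\<forall>n. outputs_within M n (poly p n) (f n))}"

definition poly_time_in_length :: "(nat \<Rightarrow> nat) set" where
  "poly_time_in_length =
     {f. \<exists>M (p :: nat poly). wf_tm M \<and> (\<forall>n. outputs_within M n (poly p (floorlog 2 n)) (f n))}"

definition linear_space_in_argument :: "(nat \<Rightarrow> nat) set" where
  "linear_space_in_argument =
     {f. \<exists>M c. wf_tm M \<and> (\<forall>n. \<exists>t. outputs_within M n t (f n) \<and> space_used M n t \<le> c * n + c)}"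

section \<open>Grzegorczyk classes\<close>

text \<open>The usual generating functions are \<open>E\<^sub>0(x, y) = x + y\<close>, \<open>E\<^sub>1(x) = x\<^sup>2 + 2\<close> and, for \<open>i \<ge> 1\<close>,
  \<open>E\<^sub>i\<^sub>+\<^sub>1(0) = 2\<close>, \<open>E\<^sub>i\<^sub>+\<^sub>1(x + 1) = E\<^sub>i(E\<^sub>i\<^sub>+\<^sub>1(x))\<close>; the \<open>n\<close>-th class contains \<open>E\<^sub>i\<close> for all \<open>i < n\<close>.
  Here \<open>grz_gen i\<close> is \<open>E\<^sub>i\<^sub>+\<^sub>1\<close>.\<close>

fun grz_gen :: "nat \<Rightarrow> nat \<Rightarrow> nat" where
  "grz_gen 0 x = x ^ 2 + 2"
| "grz_gen (Suc i) 0 = 2"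
| "grz_gen (Suc i) (Suc x) = grz_gen i (grz_gen (Suc i) x)"

inductive grzegorczyk :: "nat \<Rightarrow> nat \<Rightarrow> (nat list \<Rightarrow> nat) \<Rightarrow> bool" for n :: nat where
  zero: "grzegorczyk n k (\<lambda>xs. 0)"
| succ: "grzegorczyk n 1 (\<lambda>xs. Suc (xs ! 0))"
| proj: "i < k \<Longrightarrow> grzegorczyk n k (\<lambda>xs. xs ! i)"
| add: "0 < n \<Longrightarrow> grzegorczyk n 2 (\<lambda>xs. xs ! 0 + xs ! 1)"
| gen: "i + 1 < n \<Longrightarrow> grzegorczyk n 1 (\<lambda>xs. grz_gen i (xs ! 0))"
| comp: "grzegorczyk n (length fs) g \<Longrightarrow> \<forall>f\<in>set fs. grzegorczyk n k f \<Longrightarrow>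
    grzegorczyk n k (\<lambda>xs. g (map (\<lambda>f. f xs) fs))"
| bounded_prec: "grzegorczyk n k g \<Longrightarrow> grzegorczyk n (k + 2) h \<Longrightarrow> grzegorczyk n (k + 1) b \<Longrightarrow>
    \<forall>xs. length xs = k + 1 \<longrightarrow> prim_rec g h xs \<le> b xs \<Longrightarrow>
    grzegorczyk n (k + 1) (prim_rec g h)"
| ext: "grzegorczyk n k f \<Longrightarrow> \<forall>xs. length xs = k \<longrightarrow> g xs = f xs \<Longrightarrow> grzegorczyk n k g"

definition unary_grzegorczyk :: "nat \<Rightarrow> (nat \<Rightarrow> nat) set" where
  "unary_grzegorczyk n = {\<lambda>x. F [x] |F. grzegorczyk n 1 F}"

section \<open>Classes of computable reals\<close>

definition digit_sum :: "(nat \<Rightarrow> nat) \<Rightarrow> real" where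
  "digit_sum f = (\<Sum>i. (real (f i) - 1) / 2 ^ (i + 1))"

definition reals_of :: "(nat \<Rightarrow> nat) set \<Rightarrow> real set" where
  "reals_of C = {of_int m + digit_sum f |m f. f \<in> C \<and> range f \<subseteq> {0, 1, 2}}"

definition P_numbers :: "real set" where
  "P_numbers = reals_of poly_time_in_argument"

definition SP_numbers :: "real set" where
  "SP_numbers = reals_of poly_time_in_length"

text \<open>For \<open>n = 2\<close> the digits are those computable in space linear in the argument, not those
  in the second Grzegorczyk class.\<close>

definition E_numbers :: "nat \<Rightarrow> real set" where
  "E_numbers n =
     reals_of (if n = 2 then linear_space_in_argument else unary_grzegorczyk n)"

end

theory Submission
  imports Defs
begin

text \<open>
  Suppose that \<open>\<nu>\<close> is a computable copy of \<open>reals_of C\<close>. Repeated halving inside the copy yields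
  indices of all \<open>2\<^sup>-\<^sup>k\<close>, so one can compute an index of a given finite signed-digit sum \<open>q\<close> and
  decide \<open>\<nu> s \<le> q\<close>. This permits a diagonalization: with \<open>q\<close> the sum of the digits
  written so far, the next nonzero digit, in stage \<open>s\<close>, is \<open>1\<close> if \<open>\<nu> s \<le> q\<close> and \<open>-1\<close> otherwise. The
  later digits can at most cancel it, and they cannot cancel a digit \<open>1\<close> because some of them are positive,
  as infinitely many \<open>\<nu> s\<close> lie below \<open>-1\<close>. So the limit differs from every \<open>\<nu> s\<close>.
  Because digits \<open>0\<close> leave \<open>q\<close> unchanged, the digit of stage \<open>s\<close> may be delayed until a bounded
  computation has found it. Hence the digits can be produced with very little resources,
  and the limit is an element of \<open>reals_of C\<close> outside the range of \<open>\<nu>\<close>.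

  The delay is organized as follows. Every partial recursive function \<open>f\<close> has an approximation \<open>G\<close> in the
  second Grzegorczyk class: \<open>G (t # xs)\<close> is \<open>0\<close> or \<open>f xs + 1\<close>, and it is nonzero for all large \<open>t\<close>
  if \<open>f xs\<close> is defined (\<open>approximable\<close>; \<open>approximable_recursive\<close>). Partial functions are used as the searches
  for indices need not terminate on meaningless arguments. Replacing the functions that drive the
  construction by their approximations gives a digit sequence \<open>F\<close> in the second Grzegorczyk class
  (\<open>delayed_stages\<close>), where \<open>F [i]\<close> is the digit at position \<open>pos i\<close> and all other digits are 0.
  Thus \<open>reals_of C\<close> has no computable copy if \<open>C\<close> contains these sequences, for some strictly
  increasing computable \<open>pos\<close>, and the sequences with finite support (\<open>no_computable_copy\<close>).

  For the Grzegorczyk classes, \<open>pos\<close> is the identity. For the machine classes, \<open>pos i = 2\<^sup>i\<close>, and all of them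
  contain the functions computable in time polynomial in the length. A function in
  the second Grzegorczyk class is computed by a while program in time polynomial in its arguments, because
  bounded recursion runs through polynomially many steps on polynomially bounded values
  (\<open>compilable_grz\<close>). A Turing machine first walks along its input \<open>2\<^sup>i\<close>, checking with finitely many
  states that it is a power of two and counting its length in unary, and then simulates the program,
  each register being the head position on a tape of its own (\<open>scanned_grz_poly_time\<close>). So the digit at
  position \<open>2\<^sup>i\<close> is found in time polynomial in \<open>i\<close>.
\<close>

section \<open>Closure properties of the Grzegorczyk classes\<close>

lemma grz_compose:
  assumes "grzegorczyk n (length fs) g" "\<And>f. f \<in> set fs \<Longrightarrow> grzegorczyk n k f"
    and "\<And>xs. length xs = k \<Longrightarrow> F xs = g (map (\<lambda>f. f xs) fs)"
  shows "grzegorczyk n k F"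
  using grzegorczyk.ext[OF grzegorczyk.comp[of n fs g k]] assms by blast

lemma grz_select:
  assumes "grzegorczyk n (length js) g" "set js \<subseteq> {..<k}"
    and "\<And>xs. length xs = k \<Longrightarrow> F xs = g (map ((!) xs) js)"
  shows "grzegorczyk n k F"
proof (rule grz_compose[of n "map (\<lambda>j xs. xs ! j) js" g])
  show "grzegorczyk n k f" if "f \<in> set (map (\<lambda>j xs. xs ! j) js)" for f
    using that assms(2) by (auto intro: grzegorczyk.proj)
qed (use assms in \<open>auto simp: comp_def\<close>)

lemma grz_comp1:
  assumes "grzegorczyk n 1 g" "grzegorczyk n k a"
  shows "grzegorczyk n k (\<lambda>xs. g [a xs])"
  by (rule grz_compose[of n "[a]" g]) (use assms in auto)

lemma grz_comp2:
  assumes "grzegorczyk n 2 g" "grzegorczyk n k a" "grzegorczyk n k b"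
  shows "grzegorczyk n k (\<lambda>xs. g [a xs, b xs])"
  by (rule grz_compose[of n "[a, b]" g]) (use assms in \<open>auto simp: numeral_2_eq_2\<close>)

lemma grz_comp3:
  assumes "grzegorczyk n 3 g" "grzegorczyk n k a" "grzegorczyk n k b" "grzegorczyk n k c"
  shows "grzegorczyk n k (\<lambda>xs. g [a xs, b xs, c xs])"
  by (rule grz_compose[of n "[a, b, c]" g]) (use assms in \<open>auto simp: numeral_3_eq_3\<close>)

lemma grz_Suc: "grzegorczyk n k a \<Longrightarrow> grzegorczyk n k (\<lambda>xs. Suc (a xs))"
  using grz_comp1[OF grzegorczyk.succ] by simp

lemma grz_const: "grzegorczyk n k (\<lambda>xs. c)"
  by (induction c) (auto intro: grzegorczyk.zero grz_Suc)

lemma grz_add: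
  "0 < n \<Longrightarrow> grzegorczyk n k a \<Longrightarrow> grzegorczyk n k b \<Longrightarrow> grzegorczyk n k (\<lambda>xs. a xs + b xs)"
  using grz_comp2[OF grzegorczyk.add] by simp

lemma grz_bounded_prec:
  assumes "grzegorczyk n k g" "grzegorczyk n (k + 2) h" "grzegorczyk n (k + 1) b"
    and "\<And>m xs. length xs = k \<Longrightarrow> prim_rec g h (m # xs) = F (m # xs)"
    and "\<And>m xs. length xs = k \<Longrightarrow> F (m # xs) \<le> b (m # xs)"
  shows "grzegorczyk n (k + 1) F"
proof (rule grzegorczyk.ext[OF grzegorczyk.bounded_prec[OF assms(1-3)]])
  show "\<forall>xs. length xs = k + 1 \<longrightarrow> prim_rec g h xs \<le> b xs"
    using assms(4,5) by (metis Suc_eq_plus1 length_Suc_conv)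
  show "\<forall>xs. length xs = k + 1 \<longrightarrow> F xs = prim_rec g h xs"
    using assms(4) by (metis Suc_eq_plus1 length_Suc_conv)
qed

lemma grz_pred:
  assumes "grzegorczyk n k a"
  shows "grzegorczyk n k (\<lambda>xs. a xs - 1)"
proof -
  have "grzegorczyk n (0 + 1) (\<lambda>xs. xs ! 0 - 1)"
  proof (rule grz_bounded_prec[of n 0 "\<lambda>xs. 0" "\<lambda>xs. xs ! 0" "\<lambda>xs. xs ! 0"])
    show "prim_rec (\<lambda>xs. 0) (\<lambda>xs. xs ! 0) (m # xs) = (m # xs) ! 0 - 1" for m xs
      by (cases m) auto
  qed (auto intro: grzegorczyk.intros)
  then have "grzegorczyk n 1 (\<lambda>xs. xs ! 0 - 1)" by simp
  from grz_comp1[OF this assms] show ?thesis by simp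
qed

lemma grz_monus:
  assumes "grzegorczyk n k a" "grzegorczyk n k b"
  shows "grzegorczyk n k (\<lambda>xs. a xs - b xs)"
proof -
  have "grzegorczyk n (1 + 1) (\<lambda>xs. xs ! 1 - xs ! 0)"
  proof (rule grz_bounded_prec[of n 1 "\<lambda>xs. xs ! 0" "\<lambda>xs. xs ! 1 - 1" "\<lambda>xs. xs ! 1"])
    show "prim_rec (\<lambda>xs. xs ! 0) (\<lambda>xs. xs ! 1 - 1) (m # xs) = (m # xs) ! 1 - (m # xs) ! 0" for m xs
      by (induction m) auto
  qed (auto intro: grzegorczyk.proj grz_pred[simplified])
  then have "grzegorczyk n 2 (\<lambda>xs. xs ! 1 - xs ! 0)" by (simp add: numeral_2_eq_2)
  from grz_comp2[OF this assms(2,1)] show ?thesis by simp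
qed

lemma grz_if:
  assumes "0 < n" "grzegorczyk n k c" "grzegorczyk n k a" "grzegorczyk n k b"
  shows "grzegorczyk n k (\<lambda>xs. if c xs = 0 then a xs else b xs)"
proof -
  have "grzegorczyk n (2 + 1) (\<lambda>xs. if xs ! 0 = 0 then xs ! 1 else xs ! 2)"
  proof (rule grz_bounded_prec[of n 2 "\<lambda>xs. xs ! 0" "\<lambda>xs. xs ! 3" "\<lambda>xs. xs ! 1 + xs ! 2"])
    show "prim_rec (\<lambda>xs. xs ! 0) (\<lambda>xs. xs ! 3) (m # xs)
        = (if (m # xs) ! 0 = 0 then (m # xs) ! 1 else (m # xs) ! 2)" for m xs
      by (cases m) (auto simp: numeral_3_eq_3 numeral_2_eq_2)
  qed (use assms(1) in \<open>auto intro!: grz_add grzegorczyk.proj\<close>)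
  then have "grzegorczyk n 3 (\<lambda>xs. if xs ! 0 = 0 then xs ! 1 else xs ! 2)" by simp
  from grz_comp3[OF this assms(2-4)] show ?thesis by (simp cong: if_cong)
qed

lemma grz_if_le:
  assumes "0 < n" "grzegorczyk n k c" "grzegorczyk n k d" "grzegorczyk n k a" "grzegorczyk n k b"
  shows "grzegorczyk n k (\<lambda>xs. if c xs \<le> d xs then a xs else b xs)"
  using grz_if[OF assms(1) grz_monus[OF assms(2,3)] assms(4,5)] by simp

lemma grz_square:
  assumes "2 \<le> n" "grzegorczyk n k a"
  shows "grzegorczyk n k (\<lambda>xs. a xs ^ 2)"
proof -
  have "grzegorczyk n k (\<lambda>xs. grz_gen 0 (a xs) - 1 - 1)"
    using grz_pred[OF grz_pred[OF grz_comp1[OF grzegorczyk.gen[of 0 n] assms(2)]]] assms(1) by simp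
  then show ?thesis by simp
qed

lemma grz_if_all:
  assumes "0 < n" "\<And>f. f \<in> set fs \<Longrightarrow> grzegorczyk n k f" "grzegorczyk n k a"
  shows "grzegorczyk n k (\<lambda>xs. if \<forall>f\<in>set fs. f xs \<noteq> 0 then a xs else 0)"
  using assms(2)
proof (induction fs)
  case (Cons f fs)
  have "grzegorczyk n k (\<lambda>xs. if f xs = 0 then 0
      else (if \<forall>f\<in>set fs. f xs \<noteq> 0 then a xs else 0))"
    by (intro grz_if grzegorczyk.zero assms(1)) (use Cons in auto)
  moreover have "(\<lambda>xs. if f xs = 0 then 0 else (if \<forall>f\<in>set fs. f xs \<noteq> 0 then a xs else 0))
      = (\<lambda>xs. if \<forall>f\<in>set (f # fs). f xs \<noteq> 0 then a xs else 0)"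
    by (auto simp: fun_eq_iff)
  ultimately show ?case by simp
qed (use assms(3) in auto)

lemma grz_mono:
  assumes "grzegorczyk m k f" "m \<le> n"
  shows "grzegorczyk n k f"
  using assms(1)
proof induction
  case (comp fs g k)
  then show ?case by (auto intro: grzegorczyk.comp)
next
  case (bounded_prec k g h b)
  then show ?case by (metis grzegorczyk.bounded_prec)
next
  case (ext k f g)
  then show ?case by (auto intro: grzegorczyk.ext)
qed (use assms(2) in \<open>auto intro: grzegorczyk.intros[simplified]\<close>)

section \<open>Partial recursive functions and their approximations\<close>

text \<open>\<open>G\<close> approximates the partial function \<open>f\<close>, whose undefined values are \<open>None\<close>. Its first argument
  \<open>t\<close> bounds the effort: the value \<open>0\<close> means that \<open>f xs\<close> has not been found yet, and \<open>v + 1\<close> that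
  \<open>f xs = v\<close>. The bound \<open>G (t # xs) \<le> t\<close> makes bounded recursion applicable to approximations.\<close>

definition approximates :: "nat \<Rightarrow> (nat list \<Rightarrow> nat) \<Rightarrow> (nat list \<Rightarrow> nat option) \<Rightarrow> bool" where
  "approximates k G f \<longleftrightarrow> grzegorczyk 2 (Suc k) G \<and> (\<forall>xs. length xs = k \<longrightarrow>
     (\<forall>t. G (t # xs) \<le> t \<and> (G (t # xs) \<noteq> 0 \<longrightarrow> f xs = Some (G (t # xs) - 1))) \<and>
     (f xs \<noteq> None \<longrightarrow> (\<forall>\<^sub>F t in sequentially. G (t # xs) \<noteq> 0)))"

definition approximable :: "nat \<Rightarrow> (nat list \<Rightarrow> nat option) \<Rightarrow> bool" where
  "approximable k f \<longleftrightarrow> (\<exists>G. approximates k G f)"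

lemma approximatesD:
  assumes "approximates k G f"
  shows "grzegorczyk 2 (Suc k) G"
    and "length xs = k \<Longrightarrow> G (t # xs) \<le> t"
    and "length xs = k \<Longrightarrow> G (t # xs) \<noteq> 0 \<Longrightarrow> f xs = Some (G (t # xs) - 1)"
    and "length xs = k \<Longrightarrow> f xs \<noteq> None \<Longrightarrow> \<forall>\<^sub>F t in sequentially. G (t # xs) \<noteq> 0"
  using assms unfolding approximates_def by blast+

lemma approximable_ext:
  assumes "approximable k f" "\<And>xs. length xs = k \<Longrightarrow> g xs = f xs"
  shows "approximable k g"
  using assms unfolding approximable_def approximates_def by auto

lemma map_nth_Cons_upt: "length xs = k \<Longrightarrow> map ((!) (t # xs)) [1..<Suc k] = xs"
  by (rule nth_equalityI) (auto simp del: upt_Suc)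

lemma approximable_grz:
  assumes "grzegorczyk 2 k f"
  shows "approximable k (\<lambda>xs. Some (f xs))"
proof -
  have tail: "grzegorczyk 2 (Suc k) (\<lambda>xs. f (tl xs))"
  proof (rule grz_select[of 2 "[1..<Suc k]" f])
    show "f (tl xs) = f (map ((!) xs) [1..<Suc k])" if "length xs = Suc k" for xs
      using that map_nth_Cons_upt[of "tl xs" k "hd xs"] by (cases xs) (simp_all del: upt_Suc)
  qed (use assms in \<open>auto simp del: upt_Suc\<close>)
  define G where "G xs = (if Suc (f (tl xs)) \<le> xs ! 0 then Suc (f (tl xs)) else 0)" for xs
  have "grzegorczyk 2 (Suc k) G" unfolding G_def
    by (intro grz_if_le grz_Suc tail) (auto intro: grzegorczyk.intros)
  moreover have "\<forall>\<^sub>F t in sequentially. G (t # xs) \<noteq> 0" for xs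
    using eventually_ge_at_top[of "Suc (f xs)"] by eventually_elim (simp add: G_def)
  ultimately show ?thesis
    unfolding approximable_def approximates_def by (intro exI[of _ G]) (auto simp: G_def)
qed

lemma those_eq_Some: "those zs = Some ys \<longleftrightarrow> zs = map Some ys"
proof (induction zs arbitrary: ys)
  case (Cons z zs)
  then show ?case by (cases ys; cases z) auto
qed auto

text \<open>Composition is strict: a value is defined only if all arguments are.\<close>

lemma approximable_comp:
  assumes "approximable (length fs) g" "\<And>f. f \<in> set fs \<Longrightarrow> approximable k f"
  shows "approximable k (\<lambda>xs. Option.bind (those (map (\<lambda>f. f xs) fs)) g)"
proof -
  obtain Gg where "approximates (length fs) Gg g"
    using assms(1) unfolding approximable_def by blast
  note Gg = approximatesD[OF this]
  obtain H where "\<forall>f\<in>set fs. approximates k (H f) f"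
    using assms(2) unfolding approximable_def by metis
  then have H: "grzegorczyk 2 (Suc k) (H f)"
    "length xs = k \<Longrightarrow> H f (t # xs) \<noteq> 0 \<Longrightarrow> f xs = Some (H f (t # xs) - 1)"
    "length xs = k \<Longrightarrow> f xs \<noteq> None \<Longrightarrow> \<forall>\<^sub>F t in sequentially. H f (t # xs) \<noteq> 0"
    if "f \<in> set fs" for f t xs
    using that approximatesD[of k "H f" f] by blast+
  define A where "A zs = Gg (zs ! 0 # map (\<lambda>f. H f zs - 1) fs)" for zs
  define G where "G zs = (if \<forall>h\<in>set (map H fs). h zs \<noteq> 0 then A zs else 0)" for zs
  have "grzegorczyk 2 (Suc k) A"
  proof (rule grz_compose[of 2 "(\<lambda>xs. xs ! 0) # map (\<lambda>f xs. H f xs - 1) fs" Gg])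
    show "A xs = Gg (map (\<lambda>f. f xs) ((\<lambda>xs. xs ! 0) # map (\<lambda>f xs. H f xs - 1) fs))" for xs
      by (simp add: A_def comp_def)
  qed (use H(1) Gg(1) in \<open>auto intro: grzegorczyk.proj grz_pred[simplified]\<close>)
  then have "grzegorczyk 2 (Suc k) G"
    unfolding G_def by (intro grz_if_all) (use H(1) in auto)
  moreover have "G (t # xs) \<le> t" if "length xs = k" for t xs
    using Gg(2) by (auto simp: G_def A_def)
  moreover have "Option.bind (those (map (\<lambda>f. f xs) fs)) g = Some (G (t # xs) - 1)"
    if xs: "length xs = k" and nz: "G (t # xs) \<noteq> 0" for t xs
  proof -
    have nz': "\<forall>f\<in>set fs. H f (t # xs) \<noteq> 0" "A (t # xs) \<noteq> 0"
      using nz by (auto simp: G_def split: if_splits)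
    then have "map (\<lambda>f. f xs) fs = map Some (map (\<lambda>f. H f (t # xs) - 1) fs)"
      using H(2)[OF _ xs] by simp
    then have "those (map (\<lambda>f. f xs) fs) = Some (map (\<lambda>f. H f (t # xs) - 1) fs)"
      by (simp only: those_eq_Some)
    then show ?thesis using Gg(3)[of "map (\<lambda>f. H f (t # xs) - 1) fs" t] nz'
      by (simp add: G_def A_def)
  qed
  moreover have "\<forall>\<^sub>F t in sequentially. G (t # xs) \<noteq> 0"
    if xs: "length xs = k" and def: "Option.bind (those (map (\<lambda>f. f xs) fs)) g \<noteq> None" for xs
  proof -
    obtain ys where ys: "those (map (\<lambda>f. f xs) fs) = Some ys" and g: "g ys \<noteq> None"
      using def by (auto simp: bind_eq_None_conv)
    then have m: "map (\<lambda>f. f xs) fs = map Some ys" by (simp add: those_eq_Some)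
    then have len: "length ys = length fs" by (metis length_map)
    have some: "f xs \<noteq> None" if "f \<in> set fs" for f
    proof -
      have "f xs \<in> set (map Some ys)" using that unfolding m[symmetric] by simp
      then show ?thesis by auto
    qed
    have "\<forall>\<^sub>F t in sequentially. \<forall>f\<in>set fs. H f (t # xs) \<noteq> 0"
      by (intro eventually_ball_finite ballI H(3)[OF _ xs] some) auto
    with Gg(4)[OF len g] show ?thesis
    proof eventually_elim
      case (elim t)
      then have "map Some (map (\<lambda>f. H f (t # xs) - 1) fs) = map (\<lambda>f. f xs) fs"
        using H(2)[OF _ xs] by simp
      then have "map (\<lambda>f. H f (t # xs) - 1) fs = ys"
        unfolding m by (simp add: inj_map_eq_map del: map_map)
      then show ?case using elim by (simp add: G_def A_def)
    qed
  qed
  ultimately show ?thesis unfolding approximable_def approximates_def by (intro exI[of _ G]) blast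
qed

text \<open>Primitive recursion for partial functions, undefined as soon as one step is.\<close>

fun opt_prec :: "(nat list \<Rightarrow> nat option) \<Rightarrow> (nat list \<Rightarrow> nat option) \<Rightarrow> nat list \<Rightarrow> nat option" where
  "opt_prec g h [] = None"
| "opt_prec g h (0 # xs) = g xs"
| "opt_prec g h (Suc n # xs) = Option.bind (opt_prec g h (n # xs)) (\<lambda>r. h (n # r # xs))"

lemma approximable_prec:
  assumes "approximable k g" "approximable (k + 2) h"
  shows "approximable (k + 1) (opt_prec g h)"
proof -
  obtain Gg Gh where "approximates k Gg g" "approximates (k + 2) Gh h"
    using assms unfolding approximable_def by blast
  note Gg = approximatesD[OF this(1)] and Gh = approximatesD[OF this(2)]
  define V where "V zs = Gh (map (\<lambda>f. f zs) ((\<lambda>zs. zs ! 2) # (\<lambda>zs. zs ! 0) #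
    (\<lambda>zs. zs ! 1 - 1) # map (\<lambda>j zs. zs ! j) [3..<k + 3]))" for zs
  define h' where "h' zs = (if zs ! 1 = 0 then 0 else V zs)" for zs
  have h': "h' (n # r # t # xs) = (if r = 0 then 0 else Gh (t # n # (r - 1) # xs))"
    if "length xs = k" for n r t xs
  proof -
    have "map (\<lambda>j. (n # r # t # xs) ! j) [3..<k + 3] = xs"
      using that by (intro nth_equalityI) (auto simp: numeral_3_eq_3 simp del: upt_Suc)
    then show ?thesis by (simp add: h'_def V_def comp_def)
  qed
  have "grzegorczyk 2 (Suc k + 2) V"
    by (rule grz_compose[of 2 "(\<lambda>zs. zs ! 2) # (\<lambda>zs. zs ! 0) #
      (\<lambda>zs. zs ! 1 - 1) # map (\<lambda>j zs. zs ! j) [3..<k + 3]" Gh])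
      (use Gh(1) in \<open>auto simp: V_def intro: grzegorczyk.proj grz_pred[simplified]\<close>)
  then have h'_grz: "grzegorczyk 2 (Suc k + 2) h'"
    unfolding h'_def by (intro grz_if) (auto intro: grzegorczyk.intros(1,3))
  \<comment> \<open>The effort \<open>t\<close> is a parameter of the recursion and bounds it; intermediate results are values of
    approximations, so 0 stays 0 and the others are decreased before use.\<close>
  define R where "R = prim_rec Gg h'"
  have R_le: "R (n # t # xs) \<le> t" if "length xs = k" for n t xs
    using that Gg(2) Gh(2) by (induction n) (auto simp: R_def h')
  have R_grz: "grzegorczyk 2 (Suc k + 1) R"
    by (rule grz_bounded_prec[OF Gg(1) h'_grz grzegorczyk.proj[of 1]])
      (auto simp: R_def[symmetric] length_Suc_conv R_le)
  define G where "G zs = R (map ((!) zs) (1 # 0 # [2..<k + 2]))" for zs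
  have G: "G (t # n # xs) = R (n # t # xs)" if "length xs = k" for t n xs
  proof -
    have "map ((!) (t # n # xs)) [2..<k + 2] = xs"
      using that by (intro nth_equalityI) (auto simp: numeral_2_eq_2 simp del: upt_Suc)
    then show ?thesis by (simp add: G_def)
  qed
  have "grzegorczyk 2 (Suc (k + 1)) G"
    by (rule grz_select[of 2 "1 # 0 # [2..<k + 2]" R]) (use R_grz in \<open>auto simp: G_def simp del: upt_Suc\<close>)
  moreover have "opt_prec g h (n # xs) = Some (R (n # t # xs) - 1)"
    if "length xs = k" "R (n # t # xs) \<noteq> 0" for n t xs
    using that
  proof (induction n)
    case 0
    then show ?case using Gg(3)[of xs t] by (auto simp: R_def)
  next
    case (Suc n)
    then show ?case using Gh(3)[of "n # (R (n # t # xs) - 1) # xs" t]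
      by (auto simp: R_def h' split: if_splits)
  qed
  moreover have "\<forall>\<^sub>F t in sequentially. R (n # t # xs) \<noteq> 0"
    if "length xs = k" "opt_prec g h (n # xs) \<noteq> None" for n xs
    using that
  proof (induction n)
    case 0
    then show ?case using Gg(4)[of xs] by (auto simp: R_def)
  next
    case (Suc n)
    then obtain r where r: "opt_prec g h (n # xs) = Some r" "h (n # r # xs) \<noteq> None"
      by (auto simp: bind_eq_None_conv)
    have "\<forall>\<^sub>F t in sequentially. R (n # t # xs) \<noteq> 0" using Suc r by auto
    moreover have "\<forall>\<^sub>F t in sequentially. Gh (t # n # r # xs) \<noteq> 0"
      using Gh(4)[of "n # r # xs"] r(2) Suc.prems by auto
    ultimately show ?case
    proof eventually_elim
      case (elim t)
      then have "r = R (n # t # xs) - 1"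
        using \<open>\<And>xs t n. length xs = k \<Longrightarrow> R (n # t # xs) \<noteq> 0 \<Longrightarrow>
            opt_prec g h (n # xs) = Some (R (n # t # xs) - 1)\<close> Suc.prems(1) r(1)
        by (metis option.inject)
      with elim show ?case using Suc.prems by (simp add: R_def h')
    qed
  qed
  ultimately show ?thesis
    unfolding approximable_def approximates_def using G R_le
    by (intro exI[of _ G]) (auto simp: length_Suc_conv)
qed

text \<open>Minimization for partial functions: all values before the zero must be defined.\<close>

definition opt_minim :: "(nat list \<Rightarrow> nat option) \<Rightarrow> nat list \<Rightarrow> nat option" where
  "opt_minim f xs =
     (if \<exists>y. f (y # xs) = Some 0 \<and> (\<forall>z<y. \<exists>v. f (z # xs) = Some (Suc v))
      then Some (LEAST y. f (y # xs) = Some 0) else None)"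

lemma opt_minim_eq_Some:
  "opt_minim f xs = Some y \<longleftrightarrow> f (y # xs) = Some 0 \<and> (\<forall>z<y. \<exists>v. f (z # xs) = Some (Suc v))"
proof -
  have *: "(LEAST y. f (y # xs) = Some 0) = y"
    if "f (y # xs) = Some 0" "\<forall>z<y. \<exists>v. f (z # xs) = Some (Suc v)" for y
    using that by (intro Least_equality) (force simp: not_less[symmetric])+
  then show ?thesis unfolding opt_minim_def by auto
qed

lemma approximable_minim:
  assumes "approximable (k + 1) f"
  shows "approximable k (opt_minim f)"
proof -
  obtain Gf where "approximates (k + 1) Gf f"
    using assms unfolding approximable_def by blast
  note Gf = approximatesD(1,3,4)[OF this]
  \<comment> \<open>The search up to \<open>n\<close> yields 0 if no zero has been found, 1 if an undefined value has
    been met, and \<open>y + 2\<close> if \<open>y\<close> is the least zero.\<close>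
  define V where "V zs = Gf (map ((!) zs) (2 # 0 # [3..<k + 3]))" for zs
  have V: "V (n # r # t # xs) = Gf (t # n # xs)" if "length xs = k" for n r t xs
  proof -
    have "map ((!) (n # r # t # xs)) [3..<k + 3] = xs"
      using that by (intro nth_equalityI) (auto simp: numeral_3_eq_3 simp del: upt_Suc)
    then show ?thesis by (simp add: V_def)
  qed
  have V_grz: "grzegorczyk 2 (Suc k + 2) V"
    by (rule grz_select[of 2 "2 # 0 # [3..<k + 3]" Gf]) (use Gf(1) in \<open>auto simp: V_def simp del: upt_Suc\<close>)
  define h where "h zs = (if zs ! 1 = 0 then
      if V zs = 0 then 1 else if V zs - 1 = 0 then Suc (Suc (zs ! 0)) else 0
      else zs ! 1)" for zs
  have h_grz: "grzegorczyk 2 (Suc k + 2) h"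
    unfolding h_def
    by (intro grz_if V_grz grz_Suc grzegorczyk.proj grz_pred grz_const) auto
  define S where "S = prim_rec (\<lambda>xs. 0) h"
  have S_Suc: "S (Suc n # t # xs) = (if S (n # t # xs) = 0 then
      if Gf (t # n # xs) = 0 then 1 else if Gf (t # n # xs) = 1 then n + 2 else 0
      else S (n # t # xs))" if "length xs = k" for n t xs
    using V[OF that] by (simp add: S_def h_def)
  have S_0: "S (0 # t # xs) = 0" for t xs by (simp add: S_def)
  have S_le: "S (n # t # xs) \<le> n + 1" if "length xs = k" for n t xs
    using that by (induction n) (auto simp: S_0 S_Suc)
  have S_grz: "grzegorczyk 2 (Suc k + 1) S"
    by (rule grz_bounded_prec[OF grzegorczyk.zero h_grz grz_Suc[OF grzegorczyk.proj[of 0]]])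
      (auto simp: S_def[symmetric] length_Suc_conv S_le[simplified])
  have S_found: "S (n # t # xs) \<ge> 2 \<Longrightarrow> opt_minim f xs = Some (S (n # t # xs) - 2)"
    and S_searching: "S (n # t # xs) = 0 \<Longrightarrow> \<forall>z<n. \<exists>v. f (z # xs) = Some (Suc v)"
    if "length xs = k" for n t xs
  proof (induction n)
    case (Suc n)
    have val: "f (n # xs) = Some (Gf (t # n # xs) - 1)" if "Gf (t # n # xs) \<noteq> 0"
      using that Gf(2)[of "n # xs" t] \<open>length xs = k\<close> by simp
    {
      case 1
      then show ?case using Suc val
        by (auto simp: S_Suc[OF that] opt_minim_eq_Some split: if_splits)
    next
      case 2
      then have "Gf (t # n # xs) \<ge> 2" "S (n # t # xs) = 0"
        by (auto simp: S_Suc[OF that] split: if_splits)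
      then show ?case using Suc val by (auto simp: less_Suc_eq intro!: exI[of _ "Gf (t # n # xs) - 2"])
    }
  qed (auto simp: S_0)
  have S_reach: "S (n # t # xs) = (if n \<le> y then 0 else y + 2)"
    if "length xs = k" "f (y # xs) = Some 0" "\<forall>z<y. \<exists>v. f (z # xs) = Some (Suc v)"
      "\<forall>z\<in>{..y}. Gf (t # z # xs) \<noteq> 0" for n t xs y
  proof (induction n)
    case (Suc n)
    have val: "f (n # xs) = Some (Gf (t # n # xs) - 1)" if "n \<le> y"
      using that Gf(2)[of "n # xs" t] \<open>length xs = k\<close> \<open>\<forall>z\<in>{..y}. Gf (t # z # xs) \<noteq> 0\<close> by simp
    show ?case
    proof (cases "n \<le> y")
      case True
      consider "n = y" | "n < y" using True by linarith
      then show ?thesis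
      proof cases
        case 1
        have "Gf (t # n # xs) - 1 = 0" "Gf (t # n # xs) \<noteq> 0"
          using val[OF True] that(2,4) 1 by simp_all
        then have "Gf (t # n # xs) = 1" by linarith
        then show ?thesis using Suc 1 by (simp add: S_Suc[OF that(1)])
      next
        case 2
        then have "Gf (t # n # xs) - 1 \<noteq> 0" "Gf (t # n # xs) \<noteq> 0"
          using val[OF True] that(3,4) by fastforce+
        then have "Gf (t # n # xs) \<noteq> 1" "Gf (t # n # xs) \<noteq> 0" by simp_all
        then show ?thesis using Suc 2 by (simp add: S_Suc[OF that(1)])
      qed
    qed (use Suc in \<open>simp add: S_Suc[OF that(1)]\<close>)
  qed (simp add: S_0)
  define G where "G zs = S (map ((!) zs) (0 # 0 # [1..<Suc k])) - 1" for zs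
  have G: "G (t # xs) = S (t # t # xs) - 1" if "length xs = k" for t xs
    using map_nth_Cons_upt[OF that] by (simp add: G_def del: upt_Suc)
  have "grzegorczyk 2 (Suc k) (\<lambda>zs. S (map ((!) zs) (0 # 0 # [1..<Suc k])))"
    by (rule grz_select[of 2 "0 # 0 # [1..<Suc k]" S]) (use S_grz in \<open>auto simp del: upt_Suc\<close>)
  then have "grzegorczyk 2 (Suc k) G" unfolding G_def by (rule grz_pred)
  moreover have "G (t # xs) \<le> t" if "length xs = k" for t xs
    using S_le[OF that, of t t] by (simp add: G[OF that])
  moreover have "opt_minim f xs = Some (G (t # xs) - 1)" if "length xs = k" "G (t # xs) \<noteq> 0" for t xs
    using S_found[OF that(1), of t t] that by (simp add: G numeral_2_eq_2)
  moreover have "\<forall>\<^sub>F t in sequentially. G (t # xs) \<noteq> 0"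
    if xs: "length xs = k" and def: "opt_minim f xs \<noteq> None" for xs
  proof -
    obtain y where "opt_minim f xs = Some y" using def by auto
    then have y: "f (y # xs) = Some 0" "\<forall>z<y. \<exists>v. f (z # xs) = Some (Suc v)"
      by (auto simp: opt_minim_eq_Some)
    have "f (z # xs) \<noteq> None" if "z \<le> y" for z
      using y that by (metis le_neq_implies_less option.distinct(1))
    then have "\<forall>\<^sub>F t in sequentially. \<forall>z\<in>{..y}. Gf (t # z # xs) \<noteq> 0"
      by (intro eventually_ball_finite ballI Gf(3)) (auto simp: xs)
    with eventually_gt_at_top[of y] show ?thesis
    proof eventually_elim
      case (elim t)
      then show ?case using S_reach[OF xs y, of t t] by (simp add: G[OF xs])
    qed
  qed
  ultimately show ?thesis unfolding approximable_def approximates_def by (intro exI[of _ G]) blast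
qed

lemma approximable_recursive:
  assumes "recursive k f"
  shows "approximable k (\<lambda>xs. Some (f xs))"
  using assms
proof induction
  case (comp fs g k)
  have "approximable k (\<lambda>xs. Option.bind (those (map (\<lambda>f. f xs) (map (\<lambda>f xs. Some (f xs)) fs)))
      (\<lambda>xs. Some (g xs)))"
    by (rule approximable_comp) (use comp in auto)
  moreover have "those (map (\<lambda>f. f xs) (map (\<lambda>f xs. Some (f xs)) fs)) = Some (map (\<lambda>f. f xs) fs)" for xs
    by (simp add: those_eq_Some)
  ultimately show ?case by simp
next
  case (prec k g h)
  have "opt_prec (\<lambda>xs. Some (g xs)) (\<lambda>xs. Some (h xs)) (n # xs) = Some (prim_rec g h (n # xs))" for n xs
    by (induction n) auto
  then show ?case
    by (intro approximable_ext[OF approximable_prec[OF prec.IH]]) (auto simp: length_Suc_conv)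
next
  case (minim k f)
  have "opt_minim (\<lambda>xs. Some (f xs)) xs = Some (LEAST y. f (y # xs) = 0)" if "length xs = k" for xs
    unfolding opt_minim_eq_Some option.inject
    using minim.hyps(2) that LeastI_ex[of "\<lambda>y. f (y # xs) = 0"] not_less_Least[of _ "\<lambda>y. f (y # xs) = 0"]
    by (metis not0_implies_Suc)
  then show ?case by (intro approximable_ext[OF approximable_minim[OF minim.IH]]) auto
next
  case (ext k f g)
  then show ?case by (auto intro: approximable_ext)
qed (auto intro!: approximable_grz intro: grzegorczyk.intros grzegorczyk.succ[simplified])

section \<open>Delayed diagonalization\<close>

text \<open>An injective pairing that is easily computed and quadratically bounded; its inverses need only be
  recursive.\<close>

definition pair :: "nat \<Rightarrow> nat \<Rightarrow> nat" where
  "pair a b = (a + b)\<^sup>2 + a"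

text \<open>The construction passes through states. In a state \<open>W n\<close>, the functions \<open>U\<close> and \<open>B\<close> compute the data
  \<open>v\<close> of the next stage and the sign \<open>b\<close> of its digit. The digit appears at the first \<open>m > n\<close> at which
  the approximations of both values with effort \<open>m\<close> succeed; until then the state is unchanged and the
  digits are \<open>1\<close>, which stands for zero. The new state records \<open>v\<close> and \<open>m\<close>. It is only encoded here,
  so that \<open>F\<close> stays in the second Grzegorczyk class.\<close>

lemma delayed_stages:
  assumes "approximable 1 U" "approximable 1 B" "d \<le> 2"
  shows "\<exists>F W. grzegorczyk 2 1 F \<and> (\<forall>n. F [n] \<le> 2) \<and> F [0] = d \<and> W 0 = w \<and>
    (\<forall>n v b. U [W n] = Some v \<longrightarrow> B [W n] = Some b \<longrightarrow>
      (\<exists>m>n. (\<forall>i\<in>{n<..<m}. F [i] = 1) \<and> W m = pair v m \<and> F [m] = (if b = 0 then 0 else 2)))"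
proof -
  obtain GU GB where "approximates 1 GU U" "approximates 1 GB B"
    using assms(1,2) unfolding approximable_def by blast
  note GU = approximatesD[OF this(1)] and GB = approximatesD[OF this(2)]
  have GU2: "grzegorczyk 2 2 GU" and GB2: "grzegorczyk 2 2 GB"
    using GU(1) GB(1) by (simp_all add: numeral_2_eq_2)
  define h where "h xs = (if GU [Suc (xs ! 0), xs ! 1] = 0 then xs ! 1 else
    if GB [Suc (xs ! 0), xs ! 1] = 0 then xs ! 1 else
    (GU [Suc (xs ! 0), xs ! 1] - 1 + Suc (xs ! 0))\<^sup>2 + (GU [Suc (xs ! 0), xs ! 1] - 1))" for xs
  have h_grz: "grzegorczyk 2 (0 + 2) h"
    unfolding h_def
    by (intro grz_if grz_add grz_square grz_pred grz_comp2[OF GU2] grz_comp2[OF GB2] grz_Suc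
      grzegorczyk.proj) auto
  define W where "W n = prim_rec (\<lambda>_. w) h [n]" for n
  have W_0: "W 0 = w" by (simp add: W_def)
  have W_Suc: "W (Suc n) = (if GU [Suc n, W n] = 0 \<or> GB [Suc n, W n] = 0 then W n
      else pair (GU [Suc n, W n] - 1) (Suc n))" for n
    by (simp add: W_def h_def pair_def)
  have W_le: "W n \<le> w + ((n + n)\<^sup>2 + n)" for n
  proof (induction n)
    case (Suc n)
    have "GU [Suc n, W n] - 1 \<le> Suc n" using GU(2)[of "[W n]" "Suc n"] by simp
    then have "pair (GU [Suc n, W n] - 1) (Suc n) \<le> (Suc n + Suc n)\<^sup>2 + Suc n"
      unfolding pair_def by (intro add_mono power_mono) auto
    moreover have "(n + n)\<^sup>2 + n \<le> (Suc n + Suc n)\<^sup>2 + Suc n"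
      by (intro add_mono power_mono) auto
    ultimately show ?case using Suc by (auto simp: W_Suc)
  qed (simp add: W_0)
  have W_grz: "grzegorczyk 2 (0 + 1) (\<lambda>xs. W (xs ! 0))"
    by (rule grz_bounded_prec[OF grz_const h_grz, of "\<lambda>xs. w + ((xs ! 0 + xs ! 0)\<^sup>2 + xs ! 0)"])
      (use W_le in \<open>auto intro!: grz_add grz_square grz_const grzegorczyk.proj simp: W_def\<close>)
  define k :: "nat list \<Rightarrow> nat" where "k xs = (if GU [Suc (xs ! 0), W (xs ! 0)] = 0 then 1 else
    if GB [Suc (xs ! 0), W (xs ! 0)] = 0 then 1 else
    if GB [Suc (xs ! 0), W (xs ! 0)] - 1 = 0 then 0 else 2)" for xs
  have W2: "grzegorczyk 2 2 (\<lambda>xs. W (xs ! 0))"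
    using grz_comp1[of 2 "\<lambda>xs. W (xs ! 0)" 2 "\<lambda>xs. xs ! 0"] W_grz grzegorczyk.proj[of 0 2 2] by simp
  have "grzegorczyk 2 2 k"
    unfolding k_def
    by (intro grz_if grz_pred grz_comp2[OF GU2] grz_comp2[OF GB2] grz_Suc grz_const W2
      grzegorczyk.proj) auto
  then have k_grz: "grzegorczyk 2 (0 + 2) k" by (simp only: add_0)
  define F where "F xs = (case xs ! 0 of 0 \<Rightarrow> d | Suc n \<Rightarrow> k [n])" for xs
  have F_le: "F xs \<le> 2" for xs using assms(3) by (auto simp: F_def k_def split: nat.split)
  have k_Cons: "k (n # xs) = k [n]" for n xs by (simp add: k_def)
  have "grzegorczyk 2 (0 + 1) F"
  proof (rule grz_bounded_prec[OF grz_const[of 2 0 d] k_grz grz_const[of 2 _ 2]])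
    show "prim_rec (\<lambda>xs. d) k (m # xs) = F (m # xs)" for m xs
      by (cases m) (auto simp: F_def k_Cons[of _ "_ # _"])
  qed (use F_le in auto)
  then have F_grz: "grzegorczyk 2 1 F" by simp
  have F_Suc: "F [Suc n] = (if GU [Suc n, W n] = 0 \<or> GB [Suc n, W n] = 0 then 1
      else if GB [Suc n, W n] - 1 = 0 then 0 else 2)" for n
    by (simp add: F_def k_def)
  have "\<exists>m>n. (\<forall>i\<in>{n<..<m}. F [i] = 1) \<and> W m = pair v m \<and> F [m] = (if b = 0 then 0 else 2)"
    if v: "U [W n] = Some v" and b: "B [W n] = Some b" for n v b
  proof -
    \<comment> \<open>\<open>E m\<close> says that the next digit could appear at \<open>m + 1\<close>.\<close>
    define E where "E m \<longleftrightarrow> n \<le> m \<and> GU [Suc m, W n] \<noteq> 0 \<and> GB [Suc m, W n] \<noteq> 0" for m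
    have "\<forall>\<^sub>F t in sequentially. GU [t, W n] \<noteq> 0 \<and> GB [t, W n] \<noteq> 0 \<and> n < t"
      using GU(4)[of "[W n]"] GB(4)[of "[W n]"] v b
      by (intro eventually_conj eventually_gt_at_top) auto
    from eventually_happens'[OF sequentially_bot this]
    obtain t where "GU [t, W n] \<noteq> 0" "GB [t, W n] \<noteq> 0" "n < t" by blast
    then have "E (t - 1)" by (auto simp: E_def)
    define m where "m = (LEAST m. E m)"
    have m: "E m" unfolding m_def using \<open>E (t - 1)\<close> by (rule LeastI)
    have before: "\<not> E i" if "i < m" for i using that not_less_Least unfolding m_def by blast
    have stay: "W i = W n" if "n \<le> i" "i \<le> m" for i
      using that
    proof (induction i rule: dec_induct)
      case (step i)
      then have "\<not> E i" using before by simp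
      then show ?case using step by (auto simp: W_Suc E_def)
    qed simp
    have "F [i] = 1" if "i \<in> {n<..<Suc m}" for i
    proof -
      obtain i' where i': "i = Suc i'" using \<open>i \<in> _\<close> by (cases i) auto
      then have "\<not> E i'" "W i' = W n" using before[of i'] stay[of i'] that by auto
      then show ?thesis using i' that by (auto simp: F_Suc E_def)
    qed
    moreover have "W m = W n" "n < Suc m" using stay[of m] m by (auto simp: E_def)
    moreover have "v = GU [Suc m, W n] - 1" "b = GB [Suc m, W n] - 1"
      using GU(3)[of "[W n]" "Suc m"] GB(3)[of "[W n]" "Suc m"] v b m by (auto simp: E_def)
    ultimately show ?thesis
      using m by (intro exI[of _ "Suc m"]) (auto simp: W_Suc F_Suc E_def)
  qed
  moreover have "F [0] = d" by (simp add: F_def)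
  ultimately show ?thesis using F_grz F_le W_0 by (intro exI[of _ F] exI[of _ W]) blast
qed

section \<open>Signed-digit expansions\<close>

text \<open>The value of the first \<open>p\<close> digits.\<close>

definition digit_prefix :: "(nat \<Rightarrow> nat) \<Rightarrow> nat \<Rightarrow> real" where
  "digit_prefix f p = (\<Sum>n<p. (real (f n) - 1) / 2 ^ (n + 1))"

lemma half_powers_sums: "(\<lambda>n. 1 / 2 ^ (n + p + 1) :: real) sums (1 / 2 ^ p)"
  using sums_mult[OF power_half_series, of "1 / 2 ^ p"]
  by (simp add: power_add power_one_over field_simps)

lemma summable_digits:
  assumes "\<And>n. f n \<le> 2"
  shows "summable (\<lambda>n. (real (f n) - 1) / 2 ^ (n + 1))"
proof (rule summable_comparison_test')
  show "summable (\<lambda>n. 1 / 2 ^ (n + 1) :: real)"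
    using half_powers_sums[of 0] by (auto simp: sums_iff)
  show "norm ((real (f n) - 1) / 2 ^ (n + 1)) \<le> 1 / 2 ^ (n + 1)" if "n \<ge> 0" for n
  proof -
    have "\<bar>real (f n) - 1\<bar> \<le> 1" using assms[of n] by auto
    then show ?thesis by (simp add: abs_divide divide_right_mono)
  qed
qed

lemma digit_sum_split:
  assumes "\<And>n. f n \<le> 2"
  shows "digit_sum f = digit_prefix f p + (\<Sum>n. (real (f (n + p)) - 1) / 2 ^ (n + p + 1))"
  unfolding digit_sum_def digit_prefix_def
  using suminf_split_initial_segment[OF summable_digits[of f, OF assms], of p] by simp

lemma digit_sum_finite:
  assumes "\<And>n. p \<le> n \<Longrightarrow> f n = 1"
  shows "digit_sum f = digit_prefix f p"
  unfolding digit_sum_def digit_prefix_def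
  by (rule suminf_finite) (use assms in \<open>auto simp: not_less\<close>)

lemma digit_tail_le:
  assumes "\<And>n. f n \<le> 2"
  shows "(\<Sum>n. (real (f (n + p)) - 1) / 2 ^ (n + p + 1)) \<le> 1 / 2 ^ p"
proof -
  have "(\<Sum>n. (real (f (n + p)) - 1) / 2 ^ (n + p + 1)) \<le> (\<Sum>n. 1 / 2 ^ (n + p + 1))"
  proof (rule suminf_le)
    show "summable (\<lambda>n. (real (f (n + p)) - 1) / 2 ^ (n + p + 1))"
      using summable_ignore_initial_segment[OF summable_digits[of f, OF assms], of p] by simp
    show "summable (\<lambda>n. 1 / 2 ^ (n + p + 1) :: real)"
      using half_powers_sums[of p] by (simp add: sums_iff)
    show "(real (f (n + p)) - 1) / 2 ^ (n + p + 1) \<le> 1 / 2 ^ (n + p + 1)" for n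
      using assms[of "n + p"] by (intro divide_right_mono) auto
  qed
  then show ?thesis using half_powers_sums[of p] by (simp add: sums_iff)
qed

lemma digit_tail_gt:
  assumes "\<And>n. f n \<le> 2" "p \<le> m" "f m \<noteq> 0"
  shows "- 1 / 2 ^ p < (\<Sum>n. (real (f (n + p)) - 1) / 2 ^ (n + p + 1))"
proof -
  let ?a = "\<lambda>n. (real (f (n + p)) - 1) / 2 ^ (n + p + 1)"
  have a: "summable ?a"
    using summable_ignore_initial_segment[OF summable_digits[of f, OF assms(1)], of p] by simp
  have b: "summable (\<lambda>n. 1 / 2 ^ (n + p + 1) :: real)"
    using half_powers_sums[of p] by (simp add: sums_iff)
  have eq: "?a n + 1 / 2 ^ (n + p + 1) = real (f (n + p)) / 2 ^ (n + p + 1)" for n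
    by (simp add: diff_divide_distrib)
  have "0 < (\<Sum>n. real (f (n + p)) / 2 ^ (n + p + 1))"
    using assms(2,3) by (intro suminf_pos2[of _ "m - p"] summable_add[OF a b, unfolded eq]) auto
  then have "0 < (\<Sum>n. ?a n + 1 / 2 ^ (n + p + 1))" unfolding eq .
  then show ?thesis using suminf_add[OF a b] half_powers_sums[of p] by (simp add: sums_iff)
qed

lemma digit_sum_le_prefix:
  assumes "\<And>n. f n \<le> 2" "f p = 0"
  shows "digit_sum f \<le> digit_prefix f p"
  using digit_sum_split[of f "Suc p", OF assms(1)] digit_tail_le[of f "Suc p", OF assms(1)] assms(2)
  by (simp add: digit_prefix_def)

text \<open>The inequality is strict only if the later digits are not all minimal.\<close>

lemma digit_sum_gt_prefix:
  assumes "\<And>n. f n \<le> 2" "f p = 2" "p < m" "f m \<noteq> 0"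
  shows "digit_prefix f p < digit_sum f"
  using digit_sum_split[of f "Suc p", OF assms(1)] digit_tail_gt[of f "Suc p" m, OF assms(1)] assms(2-4)
  by (simp add: digit_prefix_def)

lemma digit_prefix_ge:
  shows "- 1 \<le> digit_prefix f p"
proof -
  have "- (1 - 1 / 2 ^ p) \<le> digit_prefix f p"
  proof (induction p)
    case (Suc p)
    have "- (1 / 2 ^ (p + 1)) \<le> (real (f p) - 1) / 2 ^ (p + 1)"
      using divide_right_mono[of "- 1" "real (f p) - 1" "2 ^ (p + 1)"] by simp
    then show ?case using Suc by (simp add: digit_prefix_def)
  qed (simp add: digit_prefix_def)
  then show ?thesis by (smt (verit) zero_le_divide_1_iff zero_le_power)
qed

text \<open>The digit sequence with the digits of \<open>F\<close> at the positions \<open>pos i\<close> and with digit zero, encoded as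
  \<open>1\<close>, elsewhere.\<close>

definition spread :: "(nat \<Rightarrow> nat) \<Rightarrow> (nat \<Rightarrow> nat) \<Rightarrow> nat \<Rightarrow> nat" where
  "spread pos F n = (if n \<in> range pos then F (inv pos n) else 1)"

lemma spread_pos: "inj pos \<Longrightarrow> spread pos F (pos i) = F i"
  by (simp add: spread_def)

lemma digit_prefix_spread:
  assumes "strict_mono pos"
  shows "digit_prefix (spread pos F) (pos P) = (\<Sum>i<P. (real (F i) - 1) / 2 ^ (pos i + 1))"
proof -
  have inj: "inj pos" using assms by (rule strict_mono_imp_inj_on)
  have "(\<Sum>i<P. (real (F i) - 1) / 2 ^ (pos i + 1))
      = (\<Sum>i<P. (real (spread pos F (pos i)) - 1) / 2 ^ (pos i + 1))"
    by (simp add: spread_pos[OF inj])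
  also have "\<dots> = (\<Sum>n\<in>pos ` {..<P}. (real (spread pos F n) - 1) / 2 ^ (n + 1))"
    using inj by (subst sum.reindex) (auto intro: inj_on_subset)
  also have "\<dots> = digit_prefix (spread pos F) (pos P)"
    unfolding digit_prefix_def
    by (rule sum.mono_neutral_left)
      (auto simp: strict_mono_less[OF assms] spread_def, (metis assms imageI lessThan_iff strict_mono_less)?)
  finally show ?thesis ..
qed

section \<open>Recursive steps in a computable copy\<close>

lemma approximable_comp1:
  assumes "approximable 1 g" "approximable k a"
  shows "approximable k (\<lambda>xs. Option.bind (a xs) (\<lambda>x. g [x]))"
proof -
  have "approximable k (\<lambda>xs. Option.bind (those (map (\<lambda>f. f xs) [a])) g)"
    by (rule approximable_comp) (use assms in auto)
  then show ?thesis
    by (rule approximable_ext) (simp split: option.split bind_split)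
qed

lemma approximable_comp2:
  assumes "approximable 2 g" "approximable k a" "approximable k b"
  shows "approximable k (\<lambda>xs. Option.bind (a xs) (\<lambda>x. Option.bind (b xs) (\<lambda>y. g [x, y])))"
proof -
  have "approximable k (\<lambda>xs. Option.bind (those (map (\<lambda>f. f xs) [a, b])) g)"
    by (rule approximable_comp) (use assms in \<open>auto simp: numeral_2_eq_2\<close>)
  then show ?thesis
    by (rule approximable_ext) (auto split: option.split bind_split)
qed

lemma approximable_comp3:
  assumes "approximable 3 g" "approximable k a" "approximable k b" "approximable k c"
  shows "approximable k (\<lambda>xs. Option.bind (a xs) (\<lambda>x. Option.bind (b xs) (\<lambda>y.
    Option.bind (c xs) (\<lambda>z. g [x, y, z]))))"
proof -
  have "approximable k (\<lambda>xs. Option.bind (those (map (\<lambda>f. f xs) [a, b, c])) g)"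
    by (rule approximable_comp) (use assms in \<open>auto simp: numeral_3_eq_3\<close>)
  then show ?thesis
    by (rule approximable_ext) (auto split: option.split bind_split)
qed

lemma approximable_proj: "i < k \<Longrightarrow> approximable k (\<lambda>xs. Some (xs ! i))"
  by (intro approximable_grz grzegorczyk.proj)

lemma approximable_const: "approximable k (\<lambda>xs. Some c)"
  by (intro approximable_grz grz_const)

text \<open>The inverses of \<open>pair\<close>: the integer square root of \<open>pair a b\<close> is \<open>a + b\<close>.\<close>

definition pair_root :: "nat \<Rightarrow> nat" where
  "pair_root w = (LEAST r. w < (Suc r)\<^sup>2)"

definition pair_fst :: "nat \<Rightarrow> nat" where
  "pair_fst w = w - (pair_root w)\<^sup>2"

definition pair_snd :: "nat \<Rightarrow> nat" where
  "pair_snd w = pair_root w - pair_fst w"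

lemma pair_root_pair: "pair_root (pair a b) = a + b"
  unfolding pair_root_def
proof (rule Least_equality)
  show "pair a b < (Suc (a + b))\<^sup>2" by (simp add: pair_def power2_eq_square)
  show "a + b \<le> r" if "pair a b < (Suc r)\<^sup>2" for r
  proof (rule ccontr)
    assume "\<not> a + b \<le> r"
    then have "(Suc r)\<^sup>2 \<le> (a + b)\<^sup>2" by (intro power_mono) auto
    with that show False by (simp add: pair_def)
  qed
qed

lemma pair_fst_pair: "pair_fst (pair a b) = a" and pair_snd_pair: "pair_snd (pair a b) = b"
  by (simp_all add: pair_fst_def pair_snd_def pair_root_pair) (simp_all add: pair_def)

lemma approximable_pair_root: "approximable 1 (\<lambda>xs. Some (pair_root (xs ! 0)))"
proof -
  \<comment> \<open>This difference vanishes if and only if \<open>xs ! 1 < (Suc (xs ! 0))\<^sup>2\<close>.\<close>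
  let ?f = "\<lambda>xs. Suc (xs ! 1) - (Suc (xs ! 0))\<^sup>2"
  have "approximable (1 + 1) (\<lambda>xs. Some (?f xs))"
    by (intro approximable_grz grz_monus grz_Suc grz_square grzegorczyk.proj) auto
  then have "approximable 1 (opt_minim (\<lambda>xs. Some (?f xs)))" by (rule approximable_minim)
  moreover have "opt_minim (\<lambda>xs. Some (?f xs)) xs = Some (pair_root (xs ! 0))" for xs
  proof -
    have "\<exists>r. xs ! 0 < (Suc r)\<^sup>2"
      by (rule exI[of _ "xs ! 0"]) (simp add: power2_eq_square)
    from LeastI_ex[OF this] have "xs ! 0 < (Suc (pair_root (xs ! 0)))\<^sup>2" by (simp add: pair_root_def)
    moreover have "\<not> xs ! 0 < (Suc r)\<^sup>2" if "r < pair_root (xs ! 0)" for r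
      using that not_less_Least unfolding pair_root_def by blast
    ultimately show ?thesis
      by (auto simp: opt_minim_eq_Some not_less Suc_diff_le)
  qed
  ultimately show ?thesis by (metis (no_types, lifting) approximable_ext)
qed

lemma approximable_pair_fst: "approximable 1 (\<lambda>xs. Some (pair_fst (xs ! 0)))"
proof -
  have "approximable 2 (\<lambda>xs. Some (xs ! 0 - (xs ! 1)\<^sup>2))"
    by (intro approximable_grz grz_monus grz_square grzegorczyk.proj) auto
  from approximable_comp2[OF this approximable_proj approximable_pair_root, of 0]
  show ?thesis by (simp add: pair_fst_def)
qed

lemma approximable_pair_snd: "approximable 1 (\<lambda>xs. Some (pair_snd (xs ! 0)))"
proof -
  have "approximable 2 (\<lambda>xs. Some (xs ! 0 - xs ! 1))"
    by (intro approximable_grz grz_monus grzegorczyk.proj) auto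
  from approximable_comp2[OF this approximable_pair_root approximable_pair_fst]
  show ?thesis by (simp add: pair_snd_def)
qed

lemma approximable_pair:
  assumes "approximable k a" "approximable k b"
  shows "approximable k (\<lambda>xs. Option.bind (a xs) (\<lambda>x. Option.bind (b xs) (\<lambda>y. Some (pair x y))))"
proof -
  have "approximable 2 (\<lambda>xs. Some (pair (xs ! 0) (xs ! 1)))"
    unfolding pair_def by (intro approximable_grz grz_add grz_square grzegorczyk.proj) auto
  from approximable_comp2[OF this assms] show ?thesis by simp
qed

lemma opt_minim_total:
  assumes "\<exists>y. P y xs"
  shows "\<exists>y. opt_minim (\<lambda>zs. Some (of_bool (\<not> P (zs ! 0) (tl zs)))) xs = Some y \<and> P y xs"
proof (intro exI conjI)
  let ?y = "LEAST y. P y xs"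
  show "P ?y xs" using assms by (rule LeastI_ex)
  then show "opt_minim (\<lambda>zs. Some (of_bool (\<not> P (zs ! 0) (tl zs)))) xs = Some ?y"
    by (auto simp: opt_minim_eq_Some dest: not_less_Least)
qed

text \<open>A computable copy of a set of reals that contains the dyadic numbers needed below.\<close>

locale dyadic_copy =
  fixes R :: "real set" and \<nu> :: "nat \<Rightarrow> real"
  assumes copy: "computable_copy (real_struct R) \<nu>"
    and dyadic: "\<And>f K. (\<And>n. f n \<le> 2) \<Longrightarrow> (\<And>n. K \<le> n \<Longrightarrow> f n = 1) \<Longrightarrow> digit_sum f \<in> R"
    and one: "1 \<in> R"
begin

lemma range: "range \<nu> = R"
  using copy by (simp add: computable_copy_def real_struct_def)

lemma approximable_Q_plus: "approximable 3 (\<lambda>xs. Some (of_bool (\<nu> (xs ! 0) + \<nu> (xs ! 1) \<le> \<nu> (xs ! 2))))"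
proof -
  have "decidable 3 (\<lambda>xs. Q_plus (map \<nu> xs))"
    using copy by (simp add: computable_copy_def real_struct_def)
  then have "approximable 3 (\<lambda>xs. Some (of_bool (Q_plus (map \<nu> xs))))"
    unfolding decidable_def by (rule approximable_recursive)
  then show ?thesis by (rule approximable_ext) (auto simp: Q_plus_def)
qed

lemma approximable_Q_minus: "approximable 3 (\<lambda>xs. Some (of_bool (\<nu> (xs ! 0) + \<nu> (xs ! 1) \<ge> \<nu> (xs ! 2))))"
proof -
  have "decidable 3 (\<lambda>xs. Q_minus (map \<nu> xs))"
    using copy by (simp add: computable_copy_def real_struct_def)
  then have "approximable 3 (\<lambda>xs. Some (of_bool (Q_minus (map \<nu> xs))))"
    unfolding decidable_def by (rule approximable_recursive)
  then show ?thesis by (rule approximable_ext) (auto simp: Q_minus_def)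
qed

definition zero_index :: nat where
  "zero_index = (SOME i. \<nu> i = 0)"

lemma zero_index: "\<nu> zero_index = 0"
proof -
  have "digit_sum (\<lambda>_. 1) = 0" by (simp add: digit_sum_def)
  then have "0 \<in> R" using dyadic[of "\<lambda>_. 1"] by simp
  then show ?thesis unfolding zero_index_def using range by (metis (mono_tags, lifting) imageE someI_ex)
qed

lemma approximable_le: "approximable 2 (\<lambda>xs. Some (of_bool (\<nu> (xs ! 0) \<le> \<nu> (xs ! 1))))"
  using approximable_comp3[OF approximable_Q_plus approximable_proj[of 0 2]
      approximable_const[of _ zero_index] approximable_proj[of 1]]
  by (simp add: zero_index)

lemma approximable_not_sum:
  "approximable 3 (\<lambda>xs. Some (of_bool (\<nu> (xs ! 0) + \<nu> (xs ! 1) \<noteq> \<nu> (xs ! 2))))"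
proof -
  have "approximable 2 (\<lambda>xs. Some (if xs ! 0 = 0 then 1 else if xs ! 1 = 0 then 1 else 0))"
    by (intro approximable_grz grz_if grz_const grzegorczyk.proj) auto
  from approximable_comp2[OF this approximable_Q_plus approximable_Q_minus]
  show ?thesis by (rule approximable_ext) auto
qed

text \<open>Indices of the negative powers of two, found by repeated halving.\<close>

definition half_power :: "nat list \<Rightarrow> nat option" where
  "half_power = opt_prec (\<lambda>_. Some (SOME i. \<nu> i = 1))
     (\<lambda>xs. opt_minim (\<lambda>zs. Some (of_bool (\<nu> (zs ! 0) + \<nu> (zs ! 0) \<noteq> \<nu> (zs ! 2)))) xs)"

lemma approximable_half_power: "approximable 1 half_power"
proof -
  have "approximable 3 (\<lambda>zs. Some (of_bool (\<nu> (zs ! 0) + \<nu> (zs ! 0) \<noteq> \<nu> (zs ! 2))))"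
    using approximable_comp3[OF approximable_not_sum approximable_proj[of 0 3]
        approximable_proj[of 0 3] approximable_proj[of 2 3]] by simp
  moreover have "0 + 2 + 1 = (3 :: nat)" by simp
  ultimately have "approximable (0 + 2)
      (opt_minim (\<lambda>zs. Some (of_bool (\<nu> (zs ! 0) + \<nu> (zs ! 0) \<noteq> \<nu> (zs ! 2)))))"
    using approximable_minim[of "0 + 2"] by presburger
  from approximable_prec[OF approximable_const this] show ?thesis
    unfolding half_power_def by simp
qed

lemma half_power_in_R: "1 / 2 ^ k \<in> R"
proof (cases k)
  case 0
  then show ?thesis using one by simp
next
  case (Suc n)
  let ?f = "(\<lambda>_. 1)(n := 2 :: nat)"
  have "digit_sum ?f = digit_prefix ?f (Suc n)" by (rule digit_sum_finite) auto
  also have "\<dots> = (\<Sum>i<n. 0) + 1 / 2 ^ k" by (simp add: digit_prefix_def Suc)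
  finally have "digit_sum ?f = 1 / 2 ^ k" by simp
  then show ?thesis using dyadic[of ?f "Suc n"] by simp
qed

lemma half_power: "\<exists>c. half_power [k] = Some c \<and> \<nu> c = 1 / 2 ^ k"
proof (induction k)
  case 0
  have "\<nu> (SOME i. \<nu> i = 1) = 1"
    using one range by (metis (mono_tags, lifting) imageE someI_ex)
  then show ?case by (simp add: half_power_def)
next
  case (Suc k)
  then obtain c where c: "half_power [k] = Some c" "\<nu> c = 1 / 2 ^ k" by blast
  obtain y where "\<nu> y = 1 / 2 ^ Suc k" using half_power_in_R range by (metis imageE)
  then have "\<nu> y + \<nu> y = \<nu> c" using c(2) by simp
  then have "\<exists>y. \<nu> y + \<nu> y = \<nu> ([k, c] ! 1)" by auto
  from opt_minim_total[of "\<lambda>y xs. \<nu> y + \<nu> y = \<nu> (xs ! 1)", OF this]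
  obtain y where "opt_minim (\<lambda>zs. Some (of_bool (\<nu> (zs ! 0) + \<nu> (zs ! 0) \<noteq> \<nu> (tl zs ! 1)))) [k, c] = Some y"
    "\<nu> y + \<nu> y = \<nu> c" by auto
  moreover have "half_power [Suc k]
      = opt_minim (\<lambda>zs. Some (of_bool (\<nu> (zs ! 0) + \<nu> (zs ! 0) \<noteq> \<nu> (zs ! 2)))) [k, c]"
    using c(1) by (simp add: half_power_def)
  moreover have "\<dots> = opt_minim (\<lambda>zs. Some (of_bool (\<nu> (zs ! 0) + \<nu> (zs ! 0) \<noteq> \<nu> (tl zs ! 1)))) [k, c]"
    by (simp add: opt_minim_def numeral_2_eq_2)
  ultimately show ?case using c(2) by (intro exI[of _ y]) auto
qed

text \<open>\<open>shift [b, j, h]\<close> searches for an index of \<open>\<nu> j - \<nu> h\<close> or, if \<open>b\<close> is not \<open>0\<close>, of \<open>\<nu> j + \<nu> h\<close>. It is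
  undefined if that number is not in \<open>R\<close>.\<close>

definition shift :: "nat list \<Rightarrow> nat option" where
  "shift = opt_minim (\<lambda>zs. Some (of_bool (if zs ! 1 = 0 then \<nu> (zs ! 0) + \<nu> (zs ! 3) \<noteq> \<nu> (zs ! 2)
     else \<nu> (zs ! 2) + \<nu> (zs ! 3) \<noteq> \<nu> (zs ! 0))))"

lemma approximable_shift: "approximable 3 shift"
proof -
  have if0: "approximable 3 (\<lambda>xs. Some (if xs ! 0 = 0 then xs ! 1 else xs ! 2))"
    by (intro approximable_grz grz_if grzegorczyk.proj) auto
  have 1: "approximable (3 + 1) (\<lambda>zs. Some (of_bool (\<nu> (zs ! 0) + \<nu> (zs ! 3) \<noteq> \<nu> (zs ! 2))))"
    using approximable_comp3[OF approximable_not_sum approximable_proj[of 0 "3 + 1"]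
        approximable_proj[of 3 "3 + 1"] approximable_proj[of 2 "3 + 1"]] by simp
  have 2: "approximable (3 + 1) (\<lambda>zs. Some (of_bool (\<nu> (zs ! 2) + \<nu> (zs ! 3) \<noteq> \<nu> (zs ! 0))))"
    using approximable_comp3[OF approximable_not_sum approximable_proj[of 2 "3 + 1"]
        approximable_proj[of 3 "3 + 1"] approximable_proj[of 0 "3 + 1"]] by simp
  have "1 < 3 + (1 :: nat)" by simp
  from approximable_comp3[OF if0 approximable_proj[OF this] 1 2]
  have "approximable (3 + 1) (\<lambda>zs. Some (of_bool (if zs ! 1 = 0 then \<nu> (zs ! 0) + \<nu> (zs ! 3) \<noteq> \<nu> (zs ! 2)
     else \<nu> (zs ! 2) + \<nu> (zs ! 3) \<noteq> \<nu> (zs ! 0))))"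
    by (rule approximable_ext) auto
  then show ?thesis unfolding shift_def by (rule approximable_minim)
qed

lemma shift:
  assumes "\<nu> j + (if b = 0 then - \<nu> h else \<nu> h) \<in> R"
  shows "\<exists>y. shift [b, j, h] = Some y \<and> \<nu> y = \<nu> j + (if b = 0 then - \<nu> h else \<nu> h)"
proof -
  define P where "P y xs \<longleftrightarrow> (if xs ! 0 = 0 then \<nu> y + \<nu> (xs ! 2) = \<nu> (xs ! 1)
    else \<nu> (xs ! 1) + \<nu> (xs ! 2) = \<nu> y)" for y and xs :: "nat list"
  have P: "P y [b, j, h] \<longleftrightarrow> \<nu> y = \<nu> j + (if b = 0 then - \<nu> h else \<nu> h)" for y
    by (auto simp: P_def)
  have "\<exists>y. P y [b, j, h]" unfolding P using assms range by (metis imageE)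
  from opt_minim_total[of P, OF this] obtain y where
    y: "opt_minim (\<lambda>zs. Some (of_bool (\<not> P (zs ! 0) (tl zs)))) [b, j, h] = Some y" "P y [b, j, h]"
    by blast
  have "shift [b, j, h] = opt_minim (\<lambda>zs. Some (of_bool (\<not> P (zs ! 0) (tl zs)))) [b, j, h]"
    by (simp add: shift_def opt_minim_def P_def numeral_2_eq_2 numeral_3_eq_3)
  with y show ?thesis by (auto simp: P)
qed

text \<open>A state \<open>pair (pair s j) P\<close> says that the digit opposing \<open>\<nu> s\<close> sits at position \<open>pos P\<close> and
  that \<open>j\<close> is an index of the sum of the digits before it. The next stage adds that digit to the sum
  and compares the result \<open>q\<close> with \<open>\<nu> (Suc s)\<close>.\<close>

lemma next_stage:
  assumes "approximable 1 (\<lambda>xs. Some (pos (xs ! 0)))"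
  obtains U B where "approximable 1 U" "approximable 1 B"
    "\<And>s j P q. q = \<nu> j + (if \<nu> s \<le> \<nu> j then 1 else - 1) / 2 ^ (pos P + 1) \<Longrightarrow> q \<in> R \<Longrightarrow>
      \<exists>j'. \<nu> j' = q \<and> U [pair (pair s j) P] = Some (pair (Suc s) j') \<and>
        B [pair (pair s j) P] = Some (of_bool (\<nu> (Suc s) \<le> q))"
proof -
  note fst_of = approximable_comp1[OF approximable_pair_fst] and snd_of = approximable_comp1[OF approximable_pair_snd]
  define s j P where "s xs = pair_fst (pair_fst (xs ! 0))" and "j xs = pair_snd (pair_fst (xs ! 0))"
    and "P xs = pair_snd (xs ! 0)" for xs
  have s: "approximable 1 (\<lambda>xs. Some (s xs))" using fst_of[OF approximable_pair_fst] by (simp add: s_def)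
  have j: "approximable 1 (\<lambda>xs. Some (j xs))" using snd_of[OF approximable_pair_fst] by (simp add: j_def)
  have P: "approximable 1 (\<lambda>xs. Some (P xs))" using approximable_pair_snd by (simp add: P_def)
  have suc: "approximable 1 (\<lambda>xs. Some (Suc (xs ! 0)))"
    by (intro approximable_grz grz_Suc grzegorczyk.proj) simp
  have h: "approximable 1 (\<lambda>xs. half_power [Suc (pos (P xs))])"
    using approximable_comp1[OF approximable_half_power
        approximable_comp1[OF suc approximable_comp1[OF assms P]]] by simp
  have b: "approximable 1 (\<lambda>xs. Some (of_bool (\<nu> (s xs) \<le> \<nu> (j xs))))"
    using approximable_comp2[OF approximable_le s j] by simp
  define U where "U xs = Option.bind (half_power [Suc (pos (P xs))]) (\<lambda>h.
    Option.bind (shift [of_bool (\<nu> (s xs) \<le> \<nu> (j xs)), j xs, h]) (\<lambda>j'. Some (pair (Suc (s xs)) j')))" for xs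
  have j': "approximable 1 (\<lambda>xs. Option.bind (half_power [Suc (pos (P xs))])
      (\<lambda>h. shift [of_bool (\<nu> (s xs) \<le> \<nu> (j xs)), j xs, h]))"
    using approximable_comp3[OF approximable_shift b j h] by simp
  have U: "approximable 1 U"
    using approximable_pair[OF approximable_comp1[OF suc s] j'] by (simp add: U_def[abs_def])
  define B where "B xs = Option.bind (U xs) (\<lambda>v. Some (of_bool (\<nu> (pair_fst v) \<le> \<nu> (pair_snd v)) :: nat))" for xs
  have "approximable 1 (\<lambda>xs. Option.bind (Some (pair_fst (xs ! 0))) (\<lambda>x.
      Option.bind (Some (pair_snd (xs ! 0))) (\<lambda>y. Some (of_bool (\<nu> x \<le> \<nu> y)))))"
    using approximable_comp2[OF approximable_le approximable_pair_fst approximable_pair_snd] by simp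
  from approximable_comp1[OF this U] have B: "approximable 1 B" by (simp add: B_def[abs_def])
  have "\<exists>j'. \<nu> j' = q \<and> U [pair (pair s0 j0) P0] = Some (pair (Suc s0) j') \<and>
      B [pair (pair s0 j0) P0] = Some (of_bool (\<nu> (Suc s0) \<le> q))"
    if q: "q = \<nu> j0 + (if \<nu> s0 \<le> \<nu> j0 then 1 else - 1) / 2 ^ (pos P0 + 1)" "q \<in> R" for s0 j0 P0 q
  proof -
    obtain c where c: "half_power [Suc (pos P0)] = Some c" "\<nu> c = 1 / 2 ^ Suc (pos P0)"
      using half_power by blast
    let ?b = "of_bool (\<nu> s0 \<le> \<nu> j0) :: nat"
    have "\<nu> j0 + (if ?b = 0 then - \<nu> c else \<nu> c) = q" using c(2) q(1) by auto
    with shift[of j0 ?b c] q(2) obtain j' where "shift [?b, j0, c] = Some j'" "\<nu> j' = q" by auto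
    then show ?thesis
      using c(1) by (intro exI[of _ j'])
        (simp add: U_def B_def s_def j_def P_def pair_fst_pair pair_snd_pair)
  qed
  with U B show thesis by (rule that)
qed

end

section \<open>Classes of reals without computable copies\<close>

theorem no_computable_copy:
  assumes mono: "strict_mono pos" and pos: "approximable 1 (\<lambda>xs. Some (pos (xs ! 0)))"
    and finite: "\<And>f K. (\<And>n. f n \<le> 2) \<Longrightarrow> (\<And>n. K \<le> n \<Longrightarrow> f n = 1) \<Longrightarrow> f \<in> C"
    and spread: "\<And>F. grzegorczyk 2 1 F \<Longrightarrow> (\<And>n. F [n] \<le> 2) \<Longrightarrow> spread pos (\<lambda>n. F [n]) \<in> C"
  shows "\<not> has_computable_copy (real_struct (reals_of C))"
proof
  assume "has_computable_copy (real_struct (reals_of C))"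
  then obtain \<nu> where copy: "computable_copy (real_struct (reals_of C)) \<nu>"
    by (auto simp: has_computable_copy_def)
  have R: "of_int m + digit_sum f \<in> reals_of C" if "f \<in> C" "\<And>n. f n \<le> 2" for m f
  proof -
    have "f n \<in> {0, 1, 2}" for n using that(2)[of n] by auto
    then have "range f \<subseteq> {0, 1, 2}" by (rule image_subsetI)
    then show ?thesis using that(1) unfolding reals_of_def by blast
  qed
  have zero: "digit_sum (\<lambda>_. 1) = 0" by (simp add: digit_sum_def)
  have ints: "of_int m \<in> reals_of C" for m
    using R[OF finite[of "\<lambda>_. 1" 0], of m] zero by simp
  interpret dyadic_copy "reals_of C" \<nu>
  proof
    show "digit_sum f \<in> reals_of C" if "\<And>n. f n \<le> 2" "\<And>n. K \<le> n \<Longrightarrow> f n = 1" for f K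
      using R[of f 0, OF finite[of f K, OF that] that(1)] by simp
    show "1 \<in> reals_of C" using ints[of 1] by simp
  qed (rule copy)
  obtain U B where UB: "approximable 1 U" "approximable 1 B"
    "\<And>s j P q. q = \<nu> j + (if \<nu> s \<le> \<nu> j then 1 else - 1) / 2 ^ (pos P + 1) \<Longrightarrow> q \<in> reals_of C \<Longrightarrow>
      \<exists>j'. \<nu> j' = q \<and> U [pair (pair s j) P] = Some (pair (Suc s) j') \<and>
        B [pair (pair s j) P] = Some (of_bool (\<nu> (Suc s) \<le> q))"
    by (rule next_stage[OF pos]) blast
  have "(if \<nu> 0 \<le> 0 then 2 else 0 :: nat) \<le> 2" by simp
  from delayed_stages[OF UB(1,2) this, of "pair (pair 0 zero_index) 0"]
  obtain F W where F: "grzegorczyk 2 1 F" "\<And>n. F [n] \<le> 2"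
    and start: "F [0] = (if \<nu> 0 \<le> 0 then 2 else 0)" "W 0 = pair (pair 0 zero_index) 0"
    and stages: "\<And>n v b. U [W n] = Some v \<Longrightarrow> B [W n] = Some b \<Longrightarrow>
      \<exists>m>n. (\<forall>i\<in>{n<..<m}. F [i] = 1) \<and> W m = pair v m \<and> F [m] = (if b = 0 then 0 else 2)"
    by blast
  define f where "f = spread pos (\<lambda>n. F [n])"
  have inj: "inj pos" using mono by (rule strict_mono_imp_inj_on)
  have f_pos: "f (pos n) = F [n]" for n by (simp add: f_def spread_pos[OF inj])
  have f_le: "f n \<le> 2" for n using F(2) by (simp add: f_def spread_def)
  define q where "q n = digit_prefix f (pos n)" for n
  have q_sum: "q n = (\<Sum>i<n. (real (F [i]) - 1) / 2 ^ (pos i + 1))" for n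
    unfolding q_def f_def by (rule digit_prefix_spread[OF mono])
  have q_R: "q n \<in> reals_of C" for n
  proof -
    define g where "g i = (if i < pos n then f i else 1)" for i
    have "digit_sum g = digit_prefix g (pos n)" by (rule digit_sum_finite) (simp add: g_def)
    also have "\<dots> = q n" by (simp add: g_def q_def digit_prefix_def)
    finally show ?thesis using dyadic[of g "pos n"] f_le by (simp add: g_def)
  qed
  \<comment> \<open>\<open>stage s n\<close>: the digit opposing \<open>\<nu> s\<close> sits at position \<open>pos n\<close>.\<close>
  define stage where "stage s n \<longleftrightarrow> (\<exists>j. W n = pair (pair s j) n \<and> \<nu> j = q n) \<and>
    F [n] = (if \<nu> s \<le> q n then 2 else 0)" for s n
  have stage_0: "stage 0 0"
    using start zero_index by (auto simp: stage_def q_sum)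
  have stage_Suc: "\<exists>m>n. stage (Suc s) m" if n: "stage s n" for s n
  proof -
    obtain j where j: "W n = pair (pair s j) n" "\<nu> j = q n" using n by (auto simp: stage_def)
    have "q (Suc n) = \<nu> j + (if \<nu> s \<le> \<nu> j then 1 else - 1) / 2 ^ (pos n + 1)"
      using n j(2) by (simp add: q_sum stage_def)
    from UB(3)[OF this q_R] obtain j' where j': "\<nu> j' = q (Suc n)" "U [W n] = Some (pair (Suc s) j')"
      "B [W n] = Some (of_bool (\<nu> (Suc s) \<le> q (Suc n)))"
      by (auto simp: j(1))
    from stages[OF j'(2,3)] obtain m where m: "n < m" "\<forall>i\<in>{n<..<m}. F [i] = 1"
      "W m = pair (pair (Suc s) j') m"
      "F [m] = (if of_bool (\<nu> (Suc s) \<le> q (Suc n)) = (0 :: nat) then 0 else 2)"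
      by blast
    have "q m = q (Suc n)"
      unfolding q_sum by (rule sum.mono_neutral_right) (use m(1,2) in auto)
    then show ?thesis using m j' by (intro exI[of _ m]) (auto simp: stage_def)
  qed
  have stage_later: "\<exists>m>n. stage (Suc (s + d)) m" if "stage s n" for s n d
  proof (induction d)
    case (Suc d)
    then show ?case using stage_Suc by (metis add_Suc_right less_trans)
  qed (use stage_Suc[OF that] in simp)
  have stage_ex: "\<exists>n. stage s n" for s
    using stage_0 stage_later[OF stage_0, of "s - 1"] by (cases s) auto
  \<comment> \<open>Infinitely many indices denote numbers below all prefixes. They force positive digits beyond
    any position, which makes the tail estimate strict.\<close>
  have small: "\<exists>s'>s. \<nu> s' \<le> - 1" for s
  proof (rule ccontr)
    assume "\<not> (\<exists>s'>s. \<nu> s' \<le> - 1)"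
    then have "{s. \<nu> s \<le> - 1} \<subseteq> {..s}" by (auto simp: not_less[symmetric])
    then have "finite (\<nu> ` {s. \<nu> s \<le> - 1})" by (meson finite_atMost finite_imageI finite_subset)
    moreover have "range (\<lambda>m. - 1 - real m) \<subseteq> \<nu> ` {s. \<nu> s \<le> - 1}"
    proof clarify
      fix m :: nat
      have "- 1 - real m \<in> range \<nu>" using ints[of "- 1 - int m"] range by simp
      then obtain i where "\<nu> i = - 1 - real m" by (metis imageE)
      then show "- 1 - real m \<in> \<nu> ` {s. \<nu> s \<le> - 1}" by (intro image_eqI[of _ _ i]) auto
    qed
    ultimately have "finite (range (\<lambda>m. - 1 - real m))" by (rule finite_subset[rotated])
    then have "finite (UNIV :: nat set)" by (rule finite_imageD) (simp add: inj_on_def)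
    then show False by simp
  qed
  have "digit_sum f \<in> range \<nu>"
    using R[OF spread[OF F] f_le[unfolded f_def], of 0] range by (simp add: f_def)
  then obtain s where s: "\<nu> s = digit_sum f" by (metis imageE)
  obtain n where n: "stage s n" using stage_ex by blast
  show False
  proof (cases "\<nu> s \<le> q n")
    case True
    obtain s' where s': "s < s'" "\<nu> s' \<le> - 1" using small by blast
    then obtain m where m: "n < m" "stage s' m"
      using stage_later[OF n, of "s' - Suc s"] by auto
    have "F [m] = 2" using m(2) s'(2) digit_prefix_ge[of f "pos m"] by (auto simp: stage_def q_def)
    then have "q n < digit_sum f"
      unfolding q_def using True n m(1) mono
      by (intro digit_sum_gt_prefix[of f "pos n" "pos m", OF f_le])
        (auto simp: f_pos stage_def strict_mono_less)
    then show False using True s by simp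
  next
    case False
    then have "F [n] = 0" using n by (auto simp: stage_def)
    then have "digit_sum f \<le> q n"
      unfolding q_def by (intro digit_sum_le_prefix[of f, OF f_le]) (simp add: f_pos)
    then show False using False s by simp
  qed
qed

section \<open>While programs\<close>

text \<open>Commands on registers that hold natural numbers. A program is a list of commands, and
  \<open>While r P\<close> repeats \<open>P\<close> as long as register \<open>r\<close> is nonzero.\<close>

datatype com = Inc nat | Dec nat | While nat "com list"

text \<open>One step of a program with a register assignment. The program is its own continuation: the list of
  commands that remain to be executed.\<close>

fun pstep :: "com list \<times> (nat \<Rightarrow> nat) \<Rightarrow> com list \<times> (nat \<Rightarrow> nat)" where
  "pstep ([], \<sigma>) = ([], \<sigma>)"
| "pstep (Inc r # K, \<sigma>) = (K, \<sigma>(r := Suc (\<sigma> r)))"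
| "pstep (Dec r # K, \<sigma>) = (K, \<sigma>(r := \<sigma> r - 1))"
| "pstep (While r P # K, \<sigma>) = (if \<sigma> r = 0 then K else P @ While r P # K, \<sigma>)"

text \<open>Started in \<open>\<sigma>\<close>, the program \<open>P\<close> ends in \<open>\<sigma>'\<close> after at most \<open>T\<close> steps, whatever follows it.\<close>

definition runs :: "com list \<Rightarrow> (nat \<Rightarrow> nat) \<Rightarrow> nat \<Rightarrow> (nat \<Rightarrow> nat) \<Rightarrow> bool" where
  "runs P \<sigma> T \<sigma>' \<longleftrightarrow> (\<exists>t\<le>T. \<forall>K. (pstep ^^ t) (P @ K, \<sigma>) = (K, \<sigma>'))"

lemma runs_mono: "runs P \<sigma> T \<sigma>' \<Longrightarrow> T \<le> T' \<Longrightarrow> runs P \<sigma> T' \<sigma>'"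
  unfolding runs_def using le_trans by blast

lemma runs_Nil: "runs [] \<sigma> 0 \<sigma>"
  by (simp add: runs_def)

lemma runs_step:
  assumes "\<And>K. pstep (P @ K, \<sigma>) = (Q @ K, \<sigma>1)" "runs Q \<sigma>1 T \<sigma>2"
  shows "runs P \<sigma> (Suc T) \<sigma>2"
proof -
  obtain t where t: "t \<le> T" "\<forall>K. (pstep ^^ t) (Q @ K, \<sigma>1) = (K, \<sigma>2)"
    using assms(2) by (auto simp: runs_def)
  then have "\<forall>K. (pstep ^^ Suc t) (P @ K, \<sigma>) = (K, \<sigma>2)"
    by (simp add: funpow_Suc_right assms(1) del: funpow.simps)
  then show ?thesis using t(1) by (auto simp: runs_def simp del: funpow.simps intro!: exI[of _ "Suc t"])
qed

lemma runs_Inc: "runs [Inc r] \<sigma> 1 (\<sigma>(r := Suc (\<sigma> r)))"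
  using runs_step[of "[Inc r]" \<sigma> "[]", OF _ runs_Nil] by simp

lemma runs_Dec: "runs [Dec r] \<sigma> 1 (\<sigma>(r := \<sigma> r - 1))"
  using runs_step[of "[Dec r]" \<sigma> "[]", OF _ runs_Nil] by simp

lemma runs_append:
  assumes "runs P \<sigma> T \<sigma>1" "runs Q \<sigma>1 T' \<sigma>2"
  shows "runs (P @ Q) \<sigma> (T + T') \<sigma>2"
proof -
  obtain t t' where t: "t \<le> T" "\<forall>K. (pstep ^^ t) (P @ K, \<sigma>) = (K, \<sigma>1)"
    "t' \<le> T'" "\<forall>K. (pstep ^^ t') (Q @ K, \<sigma>1) = (K, \<sigma>2)"
    using assms by (auto simp: runs_def)
  then have "\<forall>K. (pstep ^^ (t' + t)) ((P @ Q) @ K, \<sigma>) = (K, \<sigma>2)"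
    by (simp add: funpow_add)
  then show ?thesis using t(1,3)
    unfolding runs_def by (intro exI[of _ "t' + t"]) auto
qed

lemma runs_Cons: "runs [c] \<sigma> T \<sigma>1 \<Longrightarrow> runs P \<sigma>1 T' \<sigma>2 \<Longrightarrow> runs (c # P) \<sigma> (T + T') \<sigma>2"
  using runs_append[of "[c]"] by simp

lemma runs_While:
  assumes "\<And>i. i < n \<Longrightarrow> s i r \<noteq> 0" "\<And>i. i < n \<Longrightarrow> runs P (s i) T (s (Suc i))" "s n r = 0"
  shows "runs [While r P] (s 0) (n * Suc T + 1) (s n)"
  using assms
proof (induction n arbitrary: s)
  case 0
  show ?case
    using runs_step[of "[While r P]" "s 0" "[]", OF _ runs_Nil] 0 by simp
next
  case (Suc n)
  have "runs [While r P] (s 1) (n * Suc T + 1) (s (Suc n))"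
    using Suc.IH[of "\<lambda>i. s (Suc i)"] Suc.prems by simp
  from runs_append[OF Suc.prems(2)[of 0] this[unfolded One_nat_def]]
  have "runs (P @ [While r P]) (s 0) (T + (n * Suc T + 1)) (s (Suc n))" by simp
  from runs_step[of "[While r P]" "s 0", OF _ this] Suc.prems(1)[of 0] show ?case
    by (simp add: algebra_simps)
qed

text \<open>Running times bound the growth of registers, so that no separate bounds on values are needed.\<close>

lemma runs_le: "runs P \<sigma> T \<sigma>' \<Longrightarrow> \<sigma>' r \<le> \<sigma> r + T"
proof -
  have step: "snd (pstep c) r \<le> snd c r + 1" for c
    by (cases c rule: pstep.cases) auto
  have "snd ((pstep ^^ t) c) r \<le> snd c r + t" for t c
    by (induction t) (auto intro: order_trans[OF step])
  from this[of _ "(P @ [], \<sigma>)"] show "runs P \<sigma> T \<sigma>' \<Longrightarrow> \<sigma>' r \<le> \<sigma> r + T"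
    unfolding runs_def by (metis add_left_mono le_trans snd_conv)
qed

lemma runs_clear: "runs [While r [Dec r]] \<sigma> (2 * \<sigma> r + 1) (\<sigma>(r := 0))"
proof -
  have "runs [Dec r] (\<sigma>(r := \<sigma> r - i)) 1 (\<sigma>(r := \<sigma> r - Suc i))" for i
    using runs_Dec[of r "\<sigma>(r := \<sigma> r - i)"] by simp
  then show ?thesis
    using runs_While[of "\<sigma> r" "\<lambda>i. \<sigma>(r := \<sigma> r - i)" r "[Dec r]" 1] by (simp add: mult_2)
qed

lemma runs_move:
  assumes "a \<noteq> b"
  shows "runs [While a [Dec a, Inc b]] \<sigma> (3 * \<sigma> a + 1) (\<sigma>(b := \<sigma> b + \<sigma> a, a := 0))"
proof -
  define s where "s i = \<sigma>(b := \<sigma> b + i, a := \<sigma> a - i)" for i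
  have "runs [Dec a, Inc b] (s i) (1 + 1) (s (Suc i))" for i
  proof (rule runs_Cons[OF runs_Dec])
    have "(s i)(a := s i a - 1, b := Suc (((s i)(a := s i a - 1)) b)) = s (Suc i)"
      using assms by (auto simp: s_def)
    then show "runs [Inc b] ((s i)(a := s i a - 1)) 1 (s (Suc i))"
      using runs_Inc[of b "(s i)(a := s i a - 1)"] by simp
  qed
  from runs_While[of "\<sigma> a" s a, OF _ this]
  have "runs [While a [Dec a, Inc b]] (s 0) (\<sigma> a * Suc (1 + 1) + 1) (s (\<sigma> a))"
    by (auto simp: s_def)
  then show ?thesis using assms by (auto simp: s_def elim: runs_mono)
qed

lemma runs_copy:
  assumes "a \<noteq> b" "a \<noteq> c" "b \<noteq> c" "\<sigma> c = 0"
  shows "runs [While a [Dec a, Inc b, Inc c], While c [Dec c, Inc a]] \<sigma> (7 * \<sigma> a + 2)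
    (\<sigma>(b := \<sigma> b + \<sigma> a))"
proof -
  define s where "s i = \<sigma>(b := \<sigma> b + i, c := i, a := \<sigma> a - i)" for i
  have "runs [Dec a, Inc b, Inc c] (s i) (1 + (1 + 1)) (s (Suc i))" for i
  proof (rule runs_Cons[OF runs_Dec], rule runs_Cons[OF runs_Inc])
    let ?s = "(s i)(a := s i a - 1, b := Suc (((s i)(a := s i a - 1)) b))"
    have "?s(c := Suc (?s c)) = s (Suc i)"
      using assms by (auto simp: s_def)
    then show "runs [Inc c] ?s 1 (s (Suc i))"
      using runs_Inc[of c ?s] by simp
  qed
  from runs_While[of "\<sigma> a" s a, OF _ this]
  have 1: "runs [While a [Dec a, Inc b, Inc c]] (s 0) (\<sigma> a * Suc (1 + (1 + 1)) + 1) (s (\<sigma> a))"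
    by (auto simp: s_def)
  have s0: "s 0 = \<sigma>" using assms by (auto simp: s_def)
  have s1: "s (\<sigma> a) c = \<sigma> a" "(s (\<sigma> a))(a := s (\<sigma> a) a + s (\<sigma> a) c, c := 0) = \<sigma>(b := \<sigma> b + \<sigma> a)"
    using assms by (auto simp: s_def)
  have "runs [While c [Dec c, Inc a]] (s (\<sigma> a)) (3 * \<sigma> a + 1) (\<sigma>(b := \<sigma> b + \<sigma> a))"
    using runs_move[of c a "s (\<sigma> a)"] assms s1 by simp
  from runs_Cons[OF 1 this] show ?thesis
    unfolding s0 by (auto elim: runs_mono)
qed

section \<open>Compilation of the second Grzegorczyk class\<close>

text \<open>For all input registers \<open>as\<close> and every output register \<open>out\<close>, some program stores \<open>F\<close> of the inputs in
  \<open>out\<close> and restores all other registers, in time polynomial in a bound \<open>M\<close> on the inputs. The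
  registers from \<open>m\<close> on are scratch space, zero before and after.\<close>

definition compilable :: "nat \<Rightarrow> (nat list \<Rightarrow> nat) \<Rightarrow> bool" where
  "compilable k F \<longleftrightarrow> (\<forall>as out m.
     length as = k \<and> set as \<subseteq> {..<m} \<and> out < m \<and> out \<notin> set as \<longrightarrow>
     (\<exists>P p. \<forall>\<sigma> M. (\<forall>r\<ge>m. \<sigma> r = 0) \<and> \<sigma> out = 0 \<and> (\<forall>a\<in>set as. \<sigma> a \<le> M) \<longrightarrow>
        runs P \<sigma> (poly p M) (\<sigma>(out := F (map \<sigma> as)))))"

lemma compilableI:
  assumes "\<And>as out m. length as = k \<Longrightarrow> set as \<subseteq> {..<m} \<Longrightarrow> out < m \<Longrightarrow> out \<notin> set as \<Longrightarrow>
    \<exists>P p. \<forall>\<sigma> M. (\<forall>r\<ge>m. \<sigma> r = 0) \<longrightarrow> \<sigma> out = 0 \<longrightarrow> (\<forall>a\<in>set as. \<sigma> a \<le> M) \<longrightarrow>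
        runs P \<sigma> (poly p M) (\<sigma>(out := F (map \<sigma> as)))"
  shows "compilable k F"
  unfolding compilable_def using assms by (simp add: imp_conjL)

lemma compilableE:
  assumes "compilable k F" "length as = k" "set as \<subseteq> {..<m}" "out < m" "out \<notin> set as"
  obtains P p where "\<And>\<sigma> M. (\<forall>r\<ge>m. \<sigma> r = 0) \<Longrightarrow> \<sigma> out = 0 \<Longrightarrow> (\<forall>a\<in>set as. \<sigma> a \<le> M) \<Longrightarrow>
    runs P \<sigma> (poly p M) (\<sigma>(out := F (map \<sigma> as)))"
proof -
  from assms(1)[unfolded compilable_def, rule_format, of as m out] assms(2-5)
  obtain P p where "\<forall>\<sigma> M. (\<forall>r\<ge>m. \<sigma> r = 0) \<and> \<sigma> out = 0 \<and> (\<forall>a\<in>set as. \<sigma> a \<le> M) \<longrightarrow>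
    runs P \<sigma> (poly p M) (\<sigma>(out := F (map \<sigma> as)))" by blast
  then show thesis by (intro that[of P p]) simp
qed

lemma compilable_ext:
  assumes "compilable k F" "\<And>xs. length xs = k \<Longrightarrow> G xs = F xs"
  shows "compilable k G"
  using assms unfolding compilable_def by (metis (no_types, lifting) length_map)

lemma poly_nat_mono: "x \<le> y \<Longrightarrow> poly p x \<le> poly (p :: nat poly) y"
  by (induction p) (auto intro: add_mono mult_mono)

lemma compilable_poly_bounded:
  assumes "compilable k F"
  obtains p :: "nat poly" where
    "\<And>xs M. length xs = k \<Longrightarrow> (\<forall>x\<in>set xs. x \<le> M) \<Longrightarrow> F xs \<le> poly p M"
proof -
  obtain P p where P: "\<And>\<sigma> M. (\<forall>r\<ge>Suc k. \<sigma> r = 0) \<Longrightarrow> \<sigma> k = 0 \<Longrightarrow> (\<forall>a\<in>set [0..<k]. \<sigma> a \<le> M) \<Longrightarrow>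
    runs P \<sigma> (poly p M) (\<sigma>(k := F (map \<sigma> [0..<k])))"
    by (rule compilableE[OF assms, of "[0..<k]" "Suc k" k]) auto
  show thesis
  proof
    fix xs :: "nat list" and M :: nat assume xs: "length xs = k" "\<forall>x\<in>set xs. x \<le> M"
    define \<sigma> where "\<sigma> r = (if r < k then xs ! r else 0)" for r
    have "map \<sigma> [0..<k] = xs" using xs by (auto simp: \<sigma>_def intro: nth_equalityI)
    moreover have "runs P \<sigma> (poly p M) (\<sigma>(k := F (map \<sigma> [0..<k])))"
      using xs by (intro P) (auto simp: \<sigma>_def)
    ultimately show "F xs \<le> poly p M"
      by (metis (no_types, lifting) P add_0 fun_upd_same runs_le \<sigma>_def less_irrefl)
  qed
qed

lemma compilable_zero: "compilable k (\<lambda>xs. 0)"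
proof (rule compilableI)
  fix as :: "nat list" and out m :: nat
  have "\<sigma> out = 0 \<Longrightarrow> runs [] \<sigma> (poly 0 M) (\<sigma>(out := 0))" for \<sigma> M
    using runs_Nil[of \<sigma>] by (metis fun_upd_triv poly_0)
  then show "\<exists>P p. \<forall>\<sigma> M. (\<forall>r\<ge>m. \<sigma> r = 0) \<longrightarrow> \<sigma> out = 0 \<longrightarrow> (\<forall>a\<in>set as. \<sigma> a \<le> M) \<longrightarrow>
    runs P \<sigma> (poly p M) (\<sigma>(out := 0))" by blast
qed

lemma compilable_proj:
  assumes "i < k"
  shows "compilable k (\<lambda>xs. xs ! i)"
proof (rule compilableI)
  fix as :: "nat list" and out m :: nat
  assume as: "length as = k" "set as \<subseteq> {..<m}" "out < m" "out \<notin> set as"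
  let ?a = "as ! i"
  have a: "?a \<in> set as" using as(1) assms by simp
  have "runs [While ?a [Dec ?a, Inc out, Inc m], While m [Dec m, Inc ?a]] \<sigma> (poly [:2, 7:] M)
    (\<sigma>(out := map \<sigma> as ! i))" if "\<forall>r\<ge>m. \<sigma> r = 0" "\<sigma> out = 0" "\<forall>a\<in>set as. \<sigma> a \<le> M" for \<sigma> M
    using runs_mono[OF runs_copy[of ?a out m \<sigma>], of "poly [:2, 7:] M"] a as that assms by fastforce
  then show "\<exists>P p. \<forall>\<sigma> M. (\<forall>r\<ge>m. \<sigma> r = 0) \<longrightarrow> \<sigma> out = 0 \<longrightarrow> (\<forall>a\<in>set as. \<sigma> a \<le> M) \<longrightarrow>
    runs P \<sigma> (poly p M) (\<sigma>(out := map \<sigma> as ! i))" by blast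
qed

lemma compilable_Suc:
  assumes "compilable k F"
  shows "compilable k (\<lambda>xs. Suc (F xs))"
proof (rule compilableI)
  fix as :: "nat list" and out m :: nat
  assume as: "length as = k" "set as \<subseteq> {..<m}" "out < m" "out \<notin> set as"
  then obtain P p where P: "\<And>\<sigma> M. (\<forall>r\<ge>m. \<sigma> r = 0) \<Longrightarrow> \<sigma> out = 0 \<Longrightarrow> (\<forall>a\<in>set as. \<sigma> a \<le> M) \<Longrightarrow>
    runs P \<sigma> (poly p M) (\<sigma>(out := F (map \<sigma> as)))"
    using compilableE[OF assms as] by blast
  have "runs (P @ [Inc out]) \<sigma> (poly (p + 1) M) (\<sigma>(out := Suc (F (map \<sigma> as))))"
    if "\<forall>r\<ge>m. \<sigma> r = 0" "\<sigma> out = 0" "\<forall>a\<in>set as. \<sigma> a \<le> M" for \<sigma> M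
    using runs_append[OF P[OF that] runs_Inc[of out]] by simp
  then show "\<exists>P p. \<forall>\<sigma> M. (\<forall>r\<ge>m. \<sigma> r = 0) \<longrightarrow> \<sigma> out = 0 \<longrightarrow> (\<forall>a\<in>set as. \<sigma> a \<le> M) \<longrightarrow>
    runs P \<sigma> (poly p M) (\<sigma>(out := Suc (F (map \<sigma> as))))" by blast
qed

lemma compilable_add: "compilable 2 (\<lambda>xs. xs ! 0 + xs ! 1)"
proof (rule compilableI)
  fix as :: "nat list" and out m :: nat
  assume as: "length as = 2" "set as \<subseteq> {..<m}" "out < m" "out \<notin> set as"
  then obtain a b where ab: "as = [a, b]" by (auto simp: length_Suc_conv numeral_2_eq_2)
  define copy where "copy r = [While r [Dec r, Inc out, Inc m], While m [Dec m, Inc r]]" for r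
  have "runs (copy a @ copy b) \<sigma> (poly [:4, 14:] M) (\<sigma>(out := map \<sigma> as ! 0 + map \<sigma> as ! 1))"
    if \<sigma>: "\<forall>r\<ge>m. \<sigma> r = 0" "\<sigma> out = 0" "\<forall>a\<in>set as. \<sigma> a \<le> M" for \<sigma> M
  proof -
    have "runs (copy a) \<sigma> (7 * \<sigma> a + 2) (\<sigma>(out := \<sigma> a))"
      using runs_copy[of a out m \<sigma>] \<sigma> as by (auto simp: ab copy_def)
    moreover have "runs (copy b) (\<sigma>(out := \<sigma> a)) (7 * \<sigma> b + 2) (\<sigma>(out := \<sigma> a + \<sigma> b))"
      using runs_copy[of b out m "\<sigma>(out := \<sigma> a)"] \<sigma> as by (auto simp: ab copy_def)
    ultimately have "runs (copy a @ copy b) \<sigma> (7 * \<sigma> a + 2 + (7 * \<sigma> b + 2)) (\<sigma>(out := \<sigma> a + \<sigma> b))"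
      by (rule runs_append)
    from runs_mono[OF this, of "poly [:4, 14:] M"] \<sigma>(3) show ?thesis by (simp add: ab)
  qed
  then show "\<exists>P p. \<forall>\<sigma> M. (\<forall>r\<ge>m. \<sigma> r = 0) \<longrightarrow> \<sigma> out = 0 \<longrightarrow> (\<forall>a\<in>set as. \<sigma> a \<le> M) \<longrightarrow>
    runs P \<sigma> (poly p M) (\<sigma>(out := map \<sigma> as ! 0 + map \<sigma> as ! 1))" by blast
qed

text \<open>The assignment \<open>\<sigma>\<close> with the values \<open>vs\<close> stored in consecutive registers from \<open>m\<close> on.\<close>

definition store :: "nat \<Rightarrow> nat list \<Rightarrow> (nat \<Rightarrow> nat) \<Rightarrow> nat \<Rightarrow> nat" where
  "store m vs \<sigma> r = (if m \<le> r \<and> r < m + length vs then vs ! (r - m) else \<sigma> r)"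

lemma store_snoc: "store m (vs @ [v]) \<sigma> = (store m vs \<sigma>)(m + length vs := v)"
  by (auto simp: store_def nth_append fun_eq_iff)

lemma store_Nil: "store m [] \<sigma> = \<sigma>"
  by (simp add: store_def fun_eq_iff)

lemma compile_list:
  assumes "\<And>f. f \<in> set fs \<Longrightarrow> compilable k f" "length as = k" "set as \<subseteq> {..<m}"
  shows "\<exists>P p. \<forall>\<sigma> M. (\<forall>r\<ge>m. \<sigma> r = 0) \<longrightarrow> (\<forall>a\<in>set as. \<sigma> a \<le> M) \<longrightarrow>
    runs P \<sigma> (poly p M) (store m (map (\<lambda>f. f (map \<sigma> as)) fs) \<sigma>)"
  using assms(1)
proof (induction fs rule: rev_induct)
  case Nil
  have "\<forall>\<sigma> M. runs [] \<sigma> (poly 0 M) (store m (map (\<lambda>f. f (map \<sigma> as)) []) \<sigma>)"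
    by (simp add: store_Nil runs_Nil)
  then show ?case by blast
next
  case (snoc f fs)
  then obtain P p where P: "\<forall>\<sigma> M. (\<forall>r\<ge>m. \<sigma> r = 0) \<longrightarrow> (\<forall>a\<in>set as. \<sigma> a \<le> M) \<longrightarrow>
    runs P \<sigma> (poly p M) (store m (map (\<lambda>f. f (map \<sigma> as)) fs) \<sigma>)" by auto
  let ?m = "m + length fs"
  obtain Q q where Q: "\<And>\<sigma> M. (\<forall>r\<ge>Suc ?m. \<sigma> r = 0) \<Longrightarrow> \<sigma> ?m = 0 \<Longrightarrow> (\<forall>a\<in>set as. \<sigma> a \<le> M) \<Longrightarrow>
    runs Q \<sigma> (poly q M) (\<sigma>(?m := f (map \<sigma> as)))"
    by (rule compilableE[of k f as "Suc ?m" ?m])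
      (use snoc.prems assms(2) subset_trans[OF assms(3), of "{..<Suc ?m}"] assms(3) in auto)
  have "runs (P @ Q) \<sigma> (poly (p + q) M) (store m (map (\<lambda>f. f (map \<sigma> as)) (fs @ [f])) \<sigma>)"
    if \<sigma>: "\<forall>r\<ge>m. \<sigma> r = 0" "\<forall>a\<in>set as. \<sigma> a \<le> M" for \<sigma> M
  proof -
    let ?\<sigma> = "store m (map (\<lambda>f. f (map \<sigma> as)) fs) \<sigma>"
    have low: "?\<sigma> a = \<sigma> a" if "a \<in> set as" for a
      using assms(3) that by (auto simp: store_def)
    then have map: "map ?\<sigma> as = map \<sigma> as" by simp
    have "runs Q ?\<sigma> (poly q M) (?\<sigma>(?m := f (map ?\<sigma> as)))"
      using \<sigma> low by (intro Q) (auto simp: store_def)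
    then have "runs (P @ Q) \<sigma> (poly p M + poly q M) (?\<sigma>(?m := f (map \<sigma> as)))"
      using runs_append P \<sigma> map by metis
    then show ?thesis using store_snoc[of m "map (\<lambda>f. f (map \<sigma> as)) fs"] by simp
  qed
  then show ?case by blast
qed

lemma runs_clear_store:
  assumes "\<forall>r\<ge>m. \<sigma> r = 0" "\<forall>v\<in>set vs. v \<le> B"
  shows "runs (concat (map (\<lambda>r. [While r [Dec r]]) (rev [m..<m + length vs])))
    (store m vs \<sigma>) (length vs * (2 * B + 1)) \<sigma>"
  using assms(2)
proof (induction vs rule: rev_induct)
  case Nil
  show ?case by (simp add: store_Nil runs_Nil)
next
  case (snoc v vs)
  let ?m = "m + length vs"
  have "(store m (vs @ [v]) \<sigma>)(?m := 0) = store m vs \<sigma>"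
    using assms(1) unfolding store_snoc by (auto simp: store_def)
  then have "runs [While ?m [Dec ?m]] (store m (vs @ [v]) \<sigma>) (2 * v + 1) (store m vs \<sigma>)"
    using runs_clear[of ?m "store m (vs @ [v]) \<sigma>"] by (simp add: store_snoc)
  from runs_append[OF this snoc.IH] snoc.prems show ?case
    by (auto elim!: runs_mono)
qed

lemma compilable_comp:
  assumes "compilable (length fs) g" "\<And>f. f \<in> set fs \<Longrightarrow> compilable k f"
  shows "compilable k (\<lambda>xs. g (map (\<lambda>f. f xs) fs))"
proof (rule compilableI)
  fix as :: "nat list" and out m :: nat
  assume as: "length as = k" "set as \<subseteq> {..<m}" "out < m" "out \<notin> set as"
  let ?n = "length fs"
  obtain P p where P: "\<And>\<sigma> M. (\<forall>r\<ge>m. \<sigma> r = 0) \<Longrightarrow> (\<forall>a\<in>set as. \<sigma> a \<le> M) \<Longrightarrow>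
    runs P \<sigma> (poly p M) (store m (map (\<lambda>f. f (map \<sigma> as)) fs) \<sigma>)"
    using compile_list[OF assms(2) as(1,2)] by blast
  obtain Q q where Q: "\<And>\<sigma> M. (\<forall>r\<ge>m + ?n. \<sigma> r = 0) \<Longrightarrow> \<sigma> out = 0 \<Longrightarrow>
    (\<forall>a\<in>set [m..<m + ?n]. \<sigma> a \<le> M) \<Longrightarrow>
    runs Q \<sigma> (poly q M) (\<sigma>(out := g (map \<sigma> [m..<m + ?n])))"
    by (rule compilableE[OF assms(1), of "[m..<m + ?n]" "m + ?n" out]) (use as in auto)
  define C where "C = concat (map (\<lambda>r. [While r [Dec r]]) (rev [m..<m + ?n]))"
  define b where "b = p + pcompose q p + of_nat ?n * (2 * p + 1)"
  have "runs (P @ Q @ C) \<sigma> (poly b M) (\<sigma>(out := g (map (\<lambda>f. f (map \<sigma> as)) fs)))"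
    if \<sigma>: "\<forall>r\<ge>m. \<sigma> r = 0" "\<sigma> out = 0" "\<forall>a\<in>set as. \<sigma> a \<le> M" for \<sigma> M
  proof -
    define vs where "vs = map (\<lambda>f. f (map \<sigma> as)) fs"
    have len: "length vs = ?n" by (simp add: vs_def)
    have 1: "runs P \<sigma> (poly p M) (store m vs \<sigma>)" using P \<sigma> by (simp add: vs_def)
    have le: "store m vs \<sigma> r \<le> poly p M" if "r \<ge> m" for r
      using runs_le[OF 1, of r] \<sigma>(1) that by simp
    have m: "map (store m vs \<sigma>) [m..<m + ?n] = vs"
      by (rule nth_equalityI) (auto simp: store_def len)
    have "\<forall>r\<ge>m + ?n. store m vs \<sigma> r = 0" "store m vs \<sigma> out = 0"
      using \<sigma> as(3) by (auto simp: store_def len)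
    moreover have "\<forall>a\<in>set [m..<m + ?n]. store m vs \<sigma> a \<le> poly p M" using le by auto
    ultimately have "runs Q (store m vs \<sigma>) (poly q (poly p M)) ((store m vs \<sigma>)(out := g vs))"
      using Q[of "store m vs \<sigma>" "poly p M"] unfolding m by blast
    moreover have "(store m vs \<sigma>)(out := g vs) = store m vs (\<sigma>(out := g vs))"
      using as(3) by (auto simp: store_def)
    ultimately have 2: "runs Q (store m vs \<sigma>) (poly q (poly p M)) (store m vs (\<sigma>(out := g vs)))"
      by simp
    have "\<forall>v\<in>set vs. v \<le> poly p M"
    proof
      fix v assume "v \<in> set vs"
      then obtain i where "i < length vs" "v = vs ! i" by (auto simp: in_set_conv_nth)
      then show "v \<le> poly p M" using le[of "m + i"] by (simp add: store_def)
    qed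
    then have 3: "runs C (store m vs (\<sigma>(out := g vs))) (?n * (2 * poly p M + 1)) (\<sigma>(out := g vs))"
      using runs_clear_store[of m "\<sigma>(out := g vs)" vs "poly p M"] \<sigma> as(3)
      by (simp add: C_def len)
    from runs_append[OF 1 runs_append[OF 2 3]] show ?thesis
      by (simp add: b_def vs_def poly_pcompose add.assoc)
  qed
  then show "\<exists>P p. \<forall>\<sigma> M. (\<forall>r\<ge>m. \<sigma> r = 0) \<longrightarrow> \<sigma> out = 0 \<longrightarrow> (\<forall>a\<in>set as. \<sigma> a \<le> M) \<longrightarrow>
    runs P \<sigma> (poly p M) (\<sigma>(out := g (map (\<lambda>f. f (map \<sigma> as)) fs)))" by blast
qed

lemma compilable_prec:
  assumes "compilable k g" "compilable (k + 2) h"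
    and bound: "\<And>xs M. length xs = k + 1 \<Longrightarrow> (\<forall>x\<in>set xs. x \<le> M) \<Longrightarrow> prim_rec g h xs \<le> poly b M"
  shows "compilable (k + 1) (prim_rec g h)"
proof (rule compilableI)
  fix as' :: "nat list" and out m :: nat
  assume "length as' = k + 1" and as': "set as' \<subseteq> {..<m}" "out < m" "out \<notin> set as'"
  then obtain x as where cons: "as' = x # as" and len: "length as = k"
    by (auto simp: length_Suc_conv)
  have as: "set as \<subseteq> {..<m}" "out \<notin> set as" "x < m" "x \<noteq> out"
    using as' by (auto simp: cons)
  obtain Pg pg where Pg: "\<And>\<sigma> M. (\<forall>r\<ge>m. \<sigma> r = 0) \<Longrightarrow> \<sigma> out = 0 \<Longrightarrow> (\<forall>a\<in>set as. \<sigma> a \<le> M) \<Longrightarrow>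
    runs Pg \<sigma> (poly pg M) (\<sigma>(out := g (map \<sigma> as)))"
    using compilableE[OF assms(1) len as(1) as'(2) as(2)] by blast
  let ?hs = "(m + 1) # out # as"
  obtain Ph ph where Ph: "\<And>\<sigma> M. (\<forall>r\<ge>m + 3. \<sigma> r = 0) \<Longrightarrow> \<sigma> (m + 2) = 0 \<Longrightarrow>
    (\<forall>a\<in>set ?hs. \<sigma> a \<le> M) \<Longrightarrow> runs Ph \<sigma> (poly ph M) (\<sigma>(m + 2 := h (map \<sigma> ?hs)))"
    by (rule compilableE[OF assms(2), of ?hs "m + 3" "m + 2"]) (use len as as'(2) in auto)
  \<comment> \<open>Register \<open>m\<close> counts the remaining rounds and \<open>m + 1\<close> the completed ones, \<open>out\<close> holds the current
    value, and \<open>m + 2\<close> receives the next one.\<close>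
  define copy where "copy = [While x [Dec x, Inc m, Inc (m + 1)], While (m + 1) [Dec (m + 1), Inc x]]"
  define body where "body = Dec m # Ph @ While out [Dec out] #
    While (m + 2) [Dec (m + 2), Inc out] # [Inc (m + 1)]"
  define P where "P = Pg @ copy @ While m body # [While (m + 1) [Dec (m + 1)]]"
  define T where "T = 1 + (pcompose ph ([:0, 1:] + b) + ((2 * b + 1) + ((3 * b + 1) + 1)))"
  define p where "p = pg + ([:2, 7:] + (([:0, 1:] * (1 + T) + 1) + [:1, 2:]))"
  have "runs P \<sigma> (poly p M) (\<sigma>(out := prim_rec g h (map \<sigma> as')))"
    if \<sigma>: "\<forall>r\<ge>m. \<sigma> r = 0" "\<sigma> out = 0" "\<forall>a\<in>set as'. \<sigma> a \<le> M" for \<sigma> M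
  proof -
    define R where "R j = prim_rec g h (j # map \<sigma> as)" for j
    have R_le: "R j \<le> poly b M" if "j \<le> \<sigma> x" for j
      unfolding R_def using \<sigma>(3) that len by (intro bound) (auto simp: cons)
    define s where "s j = \<sigma>(out := R j, m := \<sigma> x - j, m + 1 := j)" for j
    have 1: "runs Pg \<sigma> (poly pg M) (\<sigma>(out := R 0))"
      using Pg[of \<sigma> M] \<sigma> by (simp add: R_def cons)
    have "s 0 = \<sigma>(out := R 0, m := \<sigma> x)"
      using \<sigma> as' by (auto simp: s_def)
    then have 2: "runs copy (\<sigma>(out := R 0)) (7 * M + 2) (s 0)"
      using runs_mono[OF runs_copy[of x m "m + 1" "\<sigma>(out := R 0)"], of "7 * M + 2"] \<sigma> as as'(2)
      by (simp add: copy_def cons)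
    have body: "runs body (s j) (poly T M) (s (Suc j))" if "j < \<sigma> x" for j
    proof -
      let ?s1 = "(s j)(m := s j m - 1)" and ?v = "R (Suc j)"
      let ?s2 = "?s1(m + 2 := ?v)"
      have args: "map ?s1 ?hs = j # R j # map \<sigma> as"
        using as as'(2) by (auto simp: s_def)
      have "runs Ph ?s1 (poly ph (M + poly b M)) (?s1(m + 2 := h (map ?s1 ?hs)))"
      proof (rule Ph)
        show "\<forall>a\<in>set ?hs. ?s1 a \<le> M + poly b M"
        proof -
          have "\<sigma> x \<le> M" "\<forall>a\<in>set as. \<sigma> a \<le> M" using \<sigma>(3) by (auto simp: cons)
          moreover have "?s1 (m + 1) = j" "?s1 out = R j" using as'(2) by (auto simp: s_def)
          moreover have "?s1 a = \<sigma> a" if "a \<in> set as" for a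
            using that as by (auto simp: s_def)
          ultimately show ?thesis using R_le[of j] that by (auto simp: trans_le_add1)
        qed
      qed (use \<sigma>(1) as'(2) in \<open>auto simp: s_def\<close>)
      then have a: "runs Ph ?s1 (poly ph (M + poly b M)) ?s2"
        unfolding args by (simp add: R_def)
      let ?s3 = "?s2(out := 0)"
      have "?s2 out = R j" using as'(2) by (simp add: s_def)
      then have b: "runs [While out [Dec out]] ?s2 (2 * poly b M + 1) ?s3"
        using runs_mono[OF runs_clear[of out ?s2], of "2 * poly b M + 1"] R_le[of j] that by simp
      let ?s4 = "?s3(out := ?v, m + 2 := 0)"
      have c: "runs [While (m + 2) [Dec (m + 2), Inc out]] ?s3 (3 * poly b M + 1) ?s4"
        using runs_mono[OF runs_move[of "m + 2" out ?s3], of "3 * poly b M + 1"]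
          R_le[of "Suc j"] that as'(2) by simp
      have "?s4(m + 1 := Suc (?s4 (m + 1))) = s (Suc j)"
        using \<sigma>(1) as'(2) by (auto simp: s_def)
      then have d: "runs [Inc (m + 1)] ?s4 1 (s (Suc j))"
        using runs_Inc[of "m + 1" ?s4] by simp
      from runs_Cons[OF runs_Dec runs_append[OF a runs_Cons[OF b runs_Cons[OF c d]]]]
      show ?thesis by (simp add: body_def T_def poly_pcompose)
    qed
    have "runs [While m body] (s 0) (\<sigma> x * Suc (poly T M) + 1) (s (\<sigma> x))"
      using runs_While[of "\<sigma> x" s m, OF _ body] as'(2) by (auto simp: s_def)
    moreover have "\<sigma> x * Suc (poly T M) \<le> M * Suc (poly T M)"
      using \<sigma>(3) by (intro mult_right_mono) (auto simp: cons)
    ultimately have 3: "runs [While m body] (s 0) (M * Suc (poly T M) + 1) (s (\<sigma> x))"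
      by (auto elim: runs_mono)
    have "(s (\<sigma> x))(m + 1 := 0) = \<sigma>(out := R (\<sigma> x))" "s (\<sigma> x) (m + 1) = \<sigma> x"
      using \<sigma>(1) as'(2) by (auto simp: s_def)
    then have 4: "runs [While (m + 1) [Dec (m + 1)]] (s (\<sigma> x)) (2 * M + 1) (\<sigma>(out := R (\<sigma> x)))"
      using runs_mono[OF runs_clear[of "m + 1" "s (\<sigma> x)"], of "2 * M + 1"] \<sigma>(3) by (simp add: cons)
    from runs_append[OF 1 runs_append[OF 2 runs_Cons[OF 3 4]]] show ?thesis
      by (auto simp: P_def p_def R_def cons algebra_simps elim!: runs_mono)
  qed
  then show "\<exists>P p. \<forall>\<sigma> M. (\<forall>r\<ge>m. \<sigma> r = 0) \<longrightarrow> \<sigma> out = 0 \<longrightarrow> (\<forall>a\<in>set as'. \<sigma> a \<le> M) \<longrightarrow>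
    runs P \<sigma> (poly p M) (\<sigma>(out := prim_rec g h (map \<sigma> as')))" by blast
qed

lemma compilable_square_plus_2: "compilable 1 (\<lambda>xs. (xs ! 0)\<^sup>2 + 2)"
proof -
  define h :: "nat list \<Rightarrow> nat" where "h xs = xs ! 1 + xs ! 2" for xs
  have "compilable (1 + 2) (\<lambda>xs. (\<lambda>xs. xs ! 0 + xs ! 1) (map (\<lambda>f. f xs) [\<lambda>xs. xs ! 1, \<lambda>xs. xs ! 2]))"
    by (rule compilable_comp) (use compilable_add in \<open>auto intro: compilable_proj simp: numeral_2_eq_2\<close>)
  then have h: "compilable (1 + 2) h" by (simp add: h_def[abs_def])
  have prod: "prim_rec (\<lambda>xs. 0) h [m, y] = m * y" for m y
    by (induction m) (auto simp: h_def)
  have "compilable (1 + 1) (prim_rec (\<lambda>xs. 0) h)"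
  proof (rule compilable_prec[OF compilable_zero h, of "[:0, 0, 1:]"])
    fix xs :: "nat list" and M assume "length xs = 1 + 1" "\<forall>x\<in>set xs. x \<le> M"
    then obtain u v where "xs = [u, v]" "u \<le> M" "v \<le> M"
      by (auto simp: length_Suc_conv numeral_2_eq_2)
    then show "prim_rec (\<lambda>xs. 0) h xs \<le> poly [:0, 0, 1:] M" by (simp add: prod mult_mono)
  qed
  then have mult: "compilable (length [\<lambda>xs. xs ! 0, \<lambda>xs. xs ! 0 :: nat]) (prim_rec (\<lambda>xs. 0) h)"
    by simp
  have "compilable 1 (\<lambda>xs. prim_rec (\<lambda>xs. 0) h (map (\<lambda>f. f xs) [\<lambda>xs. xs ! 0, \<lambda>xs. xs ! 0]))"
    by (rule compilable_comp[OF mult]) (auto intro: compilable_proj)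
  from compilable_Suc[OF compilable_Suc[OF this]] show ?thesis
    by (simp add: prod power2_eq_square)
qed

text \<open>The polynomial bound on \<open>b\<close> is what keeps bounded recursion within polynomial time.\<close>

lemma compilable_grz:
  assumes "grzegorczyk 2 k F"
  shows "compilable k F"
  using assms
proof induction
  case succ
  show ?case using compilable_Suc[OF compilable_proj[of 0 1]] by simp
next
  case (gen i)
  then show ?case using compilable_square_plus_2 by simp
next
  case (comp fs g k)
  then show ?case by (intro compilable_comp) auto
next
  case (bounded_prec k g h b)
  obtain p where "\<And>xs M. length xs = k + 1 \<Longrightarrow> (\<forall>x\<in>set xs. x \<le> M) \<Longrightarrow> b xs \<le> poly p M"
    using compilable_poly_bounded[OF bounded_prec.IH(3)] by blast
  then show ?case
    using bounded_prec by (intro compilable_prec[of k g h p]) (auto intro: order_trans)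
qed (auto intro: compilable_zero compilable_proj compilable_add[simplified] compilable_ext)

section \<open>Simulation of while programs by Turing machines\<close>

fun registers :: "com list \<Rightarrow> nat set" where
  "registers [] = {}"
| "registers (Inc r # P) = insert r (registers P)"
| "registers (Dec r # P) = insert r (registers P)"
| "registers (While r Q # P) = insert r (registers Q \<union> registers P)"

lemma finite_registers: "finite (registers P)"
  by (induction P rule: registers.induct) auto

lemma registers_append: "registers (P @ Q) = registers P \<union> registers Q"
  by (induction P rule: registers.induct) auto

text \<open>The continuations that occur while \<open>P\<close> is executed in front of \<open>K\<close>.\<close>

fun continuations :: "com list \<Rightarrow> com list \<Rightarrow> com list set" where
  "continuations [] K = {K}"
| "continuations (Inc r # P) K = insert (Inc r # P @ K) (continuations P K)"
| "continuations (Dec r # P) K = insert (Dec r # P @ K) (continuations P K)"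
| "continuations (While r Q # P) K =
    insert (While r Q # P @ K) (continuations Q (While r Q # P @ K) \<union> continuations P K)"

lemma finite_continuations: "finite (continuations P K)"
  by (induction P K rule: continuations.induct) auto

lemma self_in_continuations: "P @ K \<in> continuations P K"
  by (cases P rule: registers.cases) auto

lemma continuations_closed:
  "L \<in> continuations P K \<Longrightarrow> L = K \<or> fst (pstep (L, \<sigma>)) \<in> continuations P K"
proof (induction P K rule: continuations.induct)
  case (4 r Q P K)
  then show ?case
    using self_in_continuations[of P K] self_in_continuations[of Q "While r Q # P @ K"] by auto
qed (use self_in_continuations in auto)

lemma registers_continuations:
  "L \<in> continuations P K \<Longrightarrow> registers L \<subseteq> registers P \<union> registers K"
proof (induction P K rule: continuations.induct)
  case (4 r Q P K)
  then show ?case by (auto simp: registers_append)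
qed (auto simp: registers_append)

text \<open>The states of the Turing machine, before they are numbered: \<open>Scan a\<close> reads the input with an
  automaton in state \<open>a\<close>, \<open>Run K\<close> simulates a program with continuation \<open>K\<close>, and the remaining states
  write the output.\<close>

datatype control = Start | Scan nat | Run "com list" | Out1 | Out2 | Halt

text \<open>The actions that rewrite the scanned symbols and move no head.\<close>

definition stay :: "nat list \<Rightarrow> (nat \<times> int) list" where
  "stay xs = map (\<lambda>x. (x, 0)) xs"

text \<open>Tape 0 is the input, tape 1 the output, and tape \<open>r + 2\<close> represents register \<open>r < N\<close>. The first step
  marks cell 0 of the register tapes with symbol 1, which then indicates the value zero. Scanning
  the input increments register 0 at each cell. The result of the program is taken from register 1,
  on tape 3; the output is correct if it is at most 2. The outputs 0, 1 and 2 have the codes empty, 2 and 12 (bits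
  0 and 1 are the symbols 1 and 2).\<close>

fun trans_fun :: "nat \<Rightarrow> (nat \<Rightarrow> bool \<Rightarrow> nat) \<Rightarrow> (nat \<Rightarrow> com list) \<Rightarrow> control \<Rightarrow> nat list \<Rightarrow>
    control \<times> (nat \<times> int) list" where
  "trans_fun N \<eta> prog Start xs = (Scan 0, (xs ! 0, 0) # (xs ! 1, 0) # replicate N (1, 0))"
| "trans_fun N \<eta> prog (Scan a) xs = (if xs ! 0 = 0 then (Run (prog a), stay xs)
     else (Scan (\<eta> a (xs ! 0 = 2)), (stay xs)[0 := (xs ! 0, 1), 2 := (xs ! 2, 1)]))"
| "trans_fun N \<eta> prog (Run (Inc r # K)) xs = (Run K, (stay xs)[r + 2 := (xs ! (r + 2), 1)])"
| "trans_fun N \<eta> prog (Run (Dec r # K)) xs =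
     (Run K, if xs ! (r + 2) = 1 then stay xs else (stay xs)[r + 2 := (xs ! (r + 2), - 1)])"
| "trans_fun N \<eta> prog (Run (While r P # K)) xs =
     (Run (if xs ! (r + 2) = 1 then K else P @ While r P # K), stay xs)"
| "trans_fun N \<eta> prog (Run []) xs =
     (if xs ! 3 = 1 then (Halt, stay xs) else (Out1, (stay xs)[3 := (xs ! 3, - 1)]))"
| "trans_fun N \<eta> prog Out1 xs =
     (if xs ! 3 = 1 then (Halt, (stay xs)[1 := (2, 0)]) else (Out2, (stay xs)[1 := (1, 1)]))"
| "trans_fun N \<eta> prog Out2 xs = (Halt, (stay xs)[1 := (2, 0)])"
| "trans_fun N \<eta> prog Halt xs = (Halt, stay xs)"

text \<open>The symbols under the heads.\<close>

definition scanned :: "tape list \<Rightarrow> nat list" where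
  "scanned ts = map (\<lambda>(p, t). t p) ts"

text \<open>A machine step with unnumbered states.\<close>

definition control_step :: "(control \<Rightarrow> nat list \<Rightarrow> control \<times> (nat \<times> int) list) \<Rightarrow>
    control \<times> tape list \<Rightarrow> control \<times> tape list" where
  "control_step tr c = (case c of (q, ts) \<Rightarrow>
     (case tr q (scanned ts) of (q', as) \<Rightarrow> (q', map2 act ts as)))"

lemma map2_act_stay: "map2 act ts (stay (scanned ts)) = ts"
  by (rule nth_equalityI) (auto simp: stay_def scanned_def split: prod.split)

lemma map2_act_update:
  assumes "length as = length ts"
  shows "map2 act ts (as[i := v]) = (map2 act ts as)[i := act (ts ! i) v]"
proof (cases "i < length ts")
  case True
  show ?thesis
    by (rule nth_equalityI) (use True assms in \<open>auto simp: nth_list_update\<close>)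
qed (use assms in \<open>simp add: list_update_beyond\<close>)

text \<open>A register with value \<open>v\<close> is a tape with its head at \<open>v\<close> and a mark in cell 0.\<close>

definition register_tape :: "nat \<Rightarrow> tape" where
  "register_tape v = (int v, \<lambda>j. if j = 0 then 1 else 0)"

text \<open>The tapes with input tape \<open>inp\<close>, output tape \<open>out\<close>, and registers \<open>\<sigma>\<close>.\<close>

definition mk_tapes :: "nat \<Rightarrow> tape \<Rightarrow> tape \<Rightarrow> (nat \<Rightarrow> nat) \<Rightarrow> tape list" where
  "mk_tapes N inp out \<sigma> = inp # out # map (\<lambda>r. register_tape (\<sigma> r)) [0..<N]"

lemma length_mk_tapes [simp]: "length (mk_tapes N inp out \<sigma>) = N + 2"
  by (simp add: mk_tapes_def)

lemma nth_mk_tapes: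
  "mk_tapes N inp out \<sigma> ! 0 = inp" "mk_tapes N inp out \<sigma> ! 1 = out"
  "r < N \<Longrightarrow> mk_tapes N inp out \<sigma> ! (r + 2) = register_tape (\<sigma> r)"
  by (auto simp: mk_tapes_def)

lemma scanned_mk_tapes:
  "scanned (mk_tapes N inp out \<sigma>) ! 0 = snd inp (fst inp)"
  "scanned (mk_tapes N inp out \<sigma>) ! 1 = snd out (fst out)"
  "r < N \<Longrightarrow> scanned (mk_tapes N inp out \<sigma>) ! (r + 2) = (if \<sigma> r = 0 then 1 else 0)"
  by (auto simp: mk_tapes_def scanned_def register_tape_def split: prod.split)

lemma update_mk_tapes:
  "(mk_tapes N inp out \<sigma>)[0 := inp'] = mk_tapes N inp' out \<sigma>"
  "(mk_tapes N inp out \<sigma>)[1 := out'] = mk_tapes N inp out' \<sigma>"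
  "(mk_tapes N inp out \<sigma>)[r + 2 := register_tape v] = mk_tapes N inp out (\<sigma>(r := v))"
proof -
  show "(mk_tapes N inp out \<sigma>)[r + 2 := register_tape v] = mk_tapes N inp out (\<sigma>(r := v))"
    by (rule nth_equalityI) (auto simp: mk_tapes_def nth_list_update nth_Cons split: nat.split)
qed (auto simp: mk_tapes_def)

lemma act_register_tape:
  "act (register_tape v) (if v = 0 then 1 else 0, 1) = register_tape (Suc v)"
  "v \<noteq> 0 \<Longrightarrow> act (register_tape v) (0, - 1) = register_tape (v - 1)"
  by (auto simp: register_tape_def fun_eq_iff of_nat_diff)

lemma length_stay [simp]: "length (stay xs) = length xs"
  by (simp add: stay_def)

lemma length_scanned [simp]: "length (scanned ts) = length ts"
  by (simp add: scanned_def)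

lemma control_step_Run:
  assumes "K \<noteq> []" "registers K \<subseteq> {..<N}" "pstep (K, \<sigma>) = (K', \<sigma>')"
  shows "control_step (trans_fun N \<eta> prog) (Run K, mk_tapes N inp out \<sigma>)
    = (Run K', mk_tapes N inp out \<sigma>')"
proof (cases K rule: registers.cases)
  case (2 r P)
  then show ?thesis using assms
    by (simp only: control_step_def prod.case trans_fun.simps map2_act_update length_stay
      length_scanned map2_act_stay nth_mk_tapes scanned_mk_tapes registers.simps insert_subset
      lessThan_iff act_register_tape update_mk_tapes pstep.simps prod.inject)
next
  case (3 r P)
  then have r: "r < N" using assms(2) by simp
  show ?thesis
  proof (cases "\<sigma> r = 0")
    case True
    then have "\<sigma>' = \<sigma>" using assms(3) 3 by auto
    with True 3 assms r show ?thesis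
      by (simp add: control_step_def scanned_mk_tapes[simplified] map2_act_stay)
  next
    case False
    then have "scanned (mk_tapes N inp out \<sigma>) ! (r + 2) = 0" using r by (simp only: scanned_mk_tapes) simp
    then have "control_step (trans_fun N \<eta> prog) (Run K, mk_tapes N inp out \<sigma>)
        = (Run P, (mk_tapes N inp out \<sigma>)[r + 2 := act (register_tape (\<sigma> r)) (0, - 1)])"
      using nth_mk_tapes(3)[OF r, of inp out \<sigma>]
      by (simp add: 3 control_step_def map2_act_update map2_act_stay)
    also have "\<dots> = (Run P, mk_tapes N inp out (\<sigma>(r := \<sigma> r - 1)))"
      by (simp only: act_register_tape(2)[OF False] update_mk_tapes)
    finally show ?thesis using assms(3) 3 by simp
  qed
next
  case (4 r Q P)
  then have r: "r < N" using assms(2) by simp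
  show ?thesis using assms(3) r
    by (auto simp: 4 control_step_def scanned_mk_tapes[simplified] map2_act_stay split: if_splits)
qed (use assms in simp)

lemma control_step_Scan:
  assumes "0 < N" "p < int (floorlog 2 n)" "0 \<le> p"
  shows "control_step (trans_fun N \<eta> prog) (Scan a, mk_tapes N (p, enc n) out \<sigma>)
    = (Scan (\<eta> a (bit n (nat p))), mk_tapes N (p + 1, enc n) out (\<sigma>(0 := Suc (\<sigma> 0))))"
proof -
  let ?ts = "mk_tapes N (p, enc n) out \<sigma>"
  have inp: "scanned ?ts ! 0 = (if bit n (nat p) then 2 else 1)"
    using assms by (simp only: scanned_mk_tapes) (simp add: enc_def)
  then have nz: "scanned ?ts ! 0 \<noteq> 0" by simp
  have reg: "scanned ?ts ! 2 = (if \<sigma> 0 = 0 then 1 else 0)"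
    using scanned_mk_tapes(3)[of 0 N "(p, enc n)" out \<sigma>] assms(1) by (simp add: numeral_2_eq_2)
  have "act (p, enc n) (enc n p, 1) = (p + 1, enc n)" by simp
  moreover have "scanned ?ts ! 0 = enc n p" by (simp only: scanned_mk_tapes) simp
  ultimately have 1: "act (?ts ! 0) (scanned ?ts ! 0, 1) = (p + 1, enc n)"
    by (simp only: nth_mk_tapes)
  have 2: "act (?ts ! 2) (scanned ?ts ! 2, 1) = register_tape (Suc (\<sigma> 0))"
    using nth_mk_tapes(3)[of 0 N "(p, enc n)" out \<sigma>] assms(1) act_register_tape(1)
    by (simp only: reg) (simp add: numeral_2_eq_2)
  have "control_step (trans_fun N \<eta> prog) (Scan a, ?ts)
      = (Scan (\<eta> a (scanned ?ts ! 0 = 2)), ?ts[0 := (p + 1, enc n), 2 := register_tape (Suc (\<sigma> 0))])"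
    using nz 1 2 by (simp add: control_step_def map2_act_update map2_act_stay)
  moreover have "?ts[0 := (p + 1, enc n), 2 := register_tape (Suc (\<sigma> 0))]
      = mk_tapes N (p + 1, enc n) out (\<sigma>(0 := Suc (\<sigma> 0)))"
    using update_mk_tapes(3)[of N "(p + 1, enc n)" out \<sigma> 0 "Suc (\<sigma> 0)"]
    by (simp add: update_mk_tapes(1) numeral_2_eq_2)
  ultimately show ?thesis by (simp add: inp)
qed

lemma control_step_output:
  assumes "1 < N" "\<sigma> 1 \<le> 2"
  shows "\<exists>t\<le>3. \<exists>inp' p \<sigma>'. (control_step (trans_fun N \<eta> prog) ^^ t)
    (Run [], mk_tapes N inp (0, \<lambda>_. 0) \<sigma>) = (Halt, mk_tapes N inp' (p, enc (\<sigma> 1)) \<sigma>')"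
proof -
  let ?step = "control_step (trans_fun N \<eta> prog)"
  have scan: "scanned (mk_tapes N inp out \<sigma>) ! 3 = (if \<sigma> 1 = 0 then 1 else 0)" for out \<sigma>
    using scanned_mk_tapes(3)[of 1 N inp out \<sigma>] assms(1) by (simp add: numeral_3_eq_3)
  have nth: "mk_tapes N inp out \<sigma> ! 3 = register_tape (\<sigma> 1)" for out \<sigma>
    using nth_mk_tapes(3)[of 1 N inp out \<sigma>] assms(1) by (simp add: numeral_3_eq_3)
  have upd: "(mk_tapes N inp out \<sigma>)[3 := register_tape v] = mk_tapes N inp out (\<sigma>(1 := v))" for out \<sigma> v
    using update_mk_tapes(3)[of N inp out \<sigma> 1 v] by (simp add: numeral_3_eq_3)
  have down: "?step (Run [], mk_tapes N inp out \<sigma>) = (Out1, mk_tapes N inp out (\<sigma>(1 := \<sigma> 1 - 1)))"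
    if "\<sigma> 1 \<noteq> 0" for out \<sigma>
    using that act_register_tape(2)[OF that]
    by (simp add: control_step_def scan map2_act_update map2_act_stay nth upd)
  have fl: "floorlog 2 0 = 0" "floorlog 2 (Suc 0) = 1" "floorlog 2 2 = 2"
    by (simp_all add: floorlog_def)
  consider "\<sigma> 1 = 0" | "\<sigma> 1 = 1" | "\<sigma> 1 = 2" using assms(2) by linarith
  then show ?thesis
  proof cases
    case 1
    have "enc 0 = (\<lambda>_. 0)" by (auto simp: enc_def fl)
    then have "(?step ^^ 1) (Run [], mk_tapes N inp (0, \<lambda>_. 0) \<sigma>)
        = (Halt, mk_tapes N inp (0, enc (\<sigma> 1)) \<sigma>)"
      using 1 by (simp add: control_step_def scan map2_act_stay)
    then show ?thesis by (intro exI[of _ 1] conjI) (simp, blast)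
  next
    case 2
    let ?\<sigma> = "\<sigma>(1 := 0)"
    have enc1: "(\<lambda>_. 0)(0 := 2) = enc 1" by (auto simp: enc_def fl fun_eq_iff bit_0)
    have "?step (Out1, mk_tapes N inp (0, \<lambda>_. 0) ?\<sigma>)
        = (Halt, (mk_tapes N inp (0, \<lambda>_. 0) ?\<sigma>)[1 := act (0, \<lambda>_. 0) (2, 0)])"
      using nth_mk_tapes(2)[of N inp "(0, \<lambda>_. 0)" ?\<sigma>]
      by (simp add: control_step_def scan map2_act_update map2_act_stay)
    also have "\<dots> = (Halt, mk_tapes N inp (0, enc 1) ?\<sigma>)"
      unfolding update_mk_tapes act.simps enc1 by simp
    finally have "(?step ^^ 2) (Run [], mk_tapes N inp (0, \<lambda>_. 0) \<sigma>)
        = (Halt, mk_tapes N inp (0, enc (\<sigma> 1)) ?\<sigma>)"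
      using 2 down[of \<sigma> "(0, \<lambda>_. 0)"] by (simp add: numeral_2_eq_2)
    then show ?thesis by (intro exI[of _ 2] conjI) (simp, blast)
  next
    case 3
    let ?\<sigma> = "\<sigma>(1 := 1)"
    have enc2: "((\<lambda>_. 0)(0 := 1))(1 := 2) = enc 2"
    proof
      fix j :: int
      consider "j < 0" | "j = 0" | "j = 1" | "2 \<le> j" by linarith
      then show "((\<lambda>_. 0)(0 := 1, 1 := 2)) j = enc 2 j"
        by cases (auto simp: enc_def fl bit_iff_odd)
    qed
    have "?step (Out1, mk_tapes N inp (0, \<lambda>_. 0) ?\<sigma>)
        = (Out2, (mk_tapes N inp (0, \<lambda>_. 0) ?\<sigma>)[1 := act (0, \<lambda>_. 0) (1, 1)])"
      using nth_mk_tapes(2)[of N inp "(0, \<lambda>_. 0)" ?\<sigma>]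
      by (simp add: control_step_def scan map2_act_update map2_act_stay)
    also have "\<dots> = (Out2, mk_tapes N inp (1, (\<lambda>_. 0)(0 := 1)) ?\<sigma>)"
      unfolding update_mk_tapes act.simps by simp
    finally have a: "?step (Out1, mk_tapes N inp (0, \<lambda>_. 0) ?\<sigma>)
      = (Out2, mk_tapes N inp (1, (\<lambda>_. 0)(0 := 1)) ?\<sigma>)" .
    have "?step (Out2, mk_tapes N inp (1, (\<lambda>_. 0)(0 := 1)) ?\<sigma>)
        = (Halt, (mk_tapes N inp (1, (\<lambda>_. 0)(0 := 1)) ?\<sigma>)[1 := act (1, (\<lambda>_. 0)(0 := 1)) (2, 0)])"
      using nth_mk_tapes(2)[of N inp "(1, (\<lambda>_. 0)(0 := 1))" ?\<sigma>]
      by (simp add: control_step_def map2_act_update map2_act_stay)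
    also have "\<dots> = (Halt, mk_tapes N inp (1, enc 2) ?\<sigma>)"
      unfolding update_mk_tapes act.simps enc2 by simp
    finally have "(?step ^^ 3) (Run [], mk_tapes N inp (0, \<lambda>_. 0) \<sigma>)
        = (Halt, mk_tapes N inp (1, enc (\<sigma> 1)) ?\<sigma>)"
      using 3 a down[of \<sigma> "(0, \<lambda>_. 0)"] by (simp add: numeral_3_eq_3)
    then show ?thesis by (intro exI[of _ 3] conjI) (simp, blast)
  qed
qed

text \<open>Finitely many control states can be numbered as the machine model demands, the start state
  becoming 0 and the halting state the number of the other states.\<close>

lemma machine_of_control:
  fixes tr :: "control \<Rightarrow> nat list \<Rightarrow> control \<times> (nat \<times> int) list"
  assumes "finite S" "Start \<in> S" "Halt \<notin> S" "2 \<le> k"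
    and closed: "\<And>q xs. q \<in> S \<Longrightarrow> fst (tr q xs) \<in> insert Halt S"
    and valid: "\<And>q xs. q \<in> S \<Longrightarrow> length xs = k \<Longrightarrow> set xs \<subseteq> {..<3} \<Longrightarrow>
      length (snd (tr q xs)) = k \<and> set (snd (tr q xs)) \<subseteq> {..<3} \<times> {- 1, 0, 1}"
    and halt: "\<And>xs. tr Halt xs = (Halt, stay xs)"
  shows "\<exists>M. wf_tm M \<and> (\<forall>n t ts. (control_step tr ^^ t)
    (Start, (0, enc n) # replicate (k - 1) (0, \<lambda>_. 0)) = (Halt, ts) \<longrightarrow> run M n t = (states M, ts))"
proof -
  obtain h where h: "bij_betw h (S - {Start}) {0..<card (S - {Start})}"
    using ex_bij_betw_finite_nat[of "S - {Start}"] assms(1) by auto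
  define code where "code q = (if q = Start then 0 else if q = Halt then card S else Suc (h q))" for q
  have card: "card S = Suc (card (S - {Start}))"
    using assms(1,2) by (metis card_Suc_Diff1)
  have h_less: "h q < card (S - {Start})" if "q \<in> S" "q \<noteq> Start" for q
    using bij_betwE[OF h] that by auto
  have code_less: "code q < card S" if "q \<in> S" for q
    using h_less[OF that] assms(3) that card by (auto simp: code_def)
  have inj: "inj_on code S"
  proof (rule inj_onI)
    fix q q' assume *: "q \<in> S" "q' \<in> S" "code q = code q'"
    then have "q \<noteq> Halt" "q' \<noteq> Halt" using assms(3) by auto
    with * show "q = q'"
      using inj_onD[OF bij_betw_imp_inj_on[OF h], of q q'] by (auto simp: code_def split: if_splits)
  qed
  have surj: "\<exists>q\<in>S. code q = j" if "j < card S" for j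
  proof -
    have "code ` S \<subseteq> {..<card S}" using code_less by auto
    moreover have "card (code ` S) = card {..<card S}" using card_image[OF inj] by simp
    ultimately have "code ` S = {..<card S}" by (intro card_subset_eq) auto
    with that show ?thesis by (metis imageE lessThan_iff)
  qed
  define decode where "decode = the_inv_into S code"
  have decode: "decode (code q) = q" if "q \<in> S" for q
    using the_inv_into_f_f[OF inj that] by (simp add: decode_def)
  define M where "M = \<lparr>tapes = k, states = card S, symbols = 3,
    delta = \<lambda>j xs. map_prod code id (tr (decode j) xs)\<rparr>"
  have code_Halt: "code Halt = card S" by (simp add: code_def)
  have wf: "wf_tm M"
    unfolding wf_tm_def
  proof (intro conjI allI impI)
    fix j xs assume "j < states M" and "length xs = tapes M \<and> set xs \<subseteq> {..<symbols M}"
    then have xs: "length xs = k" "set xs \<subseteq> {..<3}" by (auto simp: M_def)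
    obtain q where q: "q \<in> S" "code q = j" using surj \<open>j < states M\<close> by (auto simp: M_def)
    have "code (fst (tr q xs)) \<le> card S"
      using closed[OF q(1), of xs] code_less code_Halt by (auto intro: less_imp_le)
    with valid[OF q(1) xs] decode[OF q(1)] q(2)
    show "case delta M j xs of (q', as) \<Rightarrow> q' \<le> states M \<and> length as = tapes M \<and>
      set as \<subseteq> {..<symbols M} \<times> {- 1, 0, 1}"
      by (cases "tr q xs") (auto simp: M_def)
  qed (use assms(4) in \<open>auto simp: M_def\<close>)
  have step: "step M (code q, ts) = map_prod code id (control_step tr (q, ts)) \<and>
      fst (control_step tr (q, ts)) \<in> insert Halt S" if "q \<in> insert Halt S" for q ts
  proof (cases "q = Halt")
    case True
    then show ?thesis by (simp add: step_def M_def code_Halt control_step_def halt map2_act_stay)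
  next
    case False
    then have q: "q \<in> S" using that by simp
    obtain q' as where "tr q (scanned ts) = (q', as)" by fastforce
    then show ?thesis using code_less[OF q] decode[OF q] closed[OF q, of "scanned ts"]
      by (simp add: step_def M_def control_step_def scanned_def)
  qed
  have steps: "(step M ^^ t) (code q, ts) = map_prod code id ((control_step tr ^^ t) (q, ts)) \<and>
      fst ((control_step tr ^^ t) (q, ts)) \<in> insert Halt S" if "q \<in> insert Halt S" for q ts t
  proof (induction t)
    case (Suc t)
    obtain q' ts' where c: "(control_step tr ^^ t) (q, ts) = (q', ts')" by fastforce
    then show ?case using Suc step[of q' ts'] by (simp add: id_def)
  qed (use that in simp)
  have "run M n t = (states M, ts)" if "(control_step tr ^^ t)
    (Start, (0, enc n) # replicate (k - 1) (0, \<lambda>_. 0)) = (Halt, ts)" for n t ts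
  proof -
    have "code Start = 0" by (simp add: code_def)
    then have "init M n = (code Start, (0, enc n) # replicate (k - 1) (0, \<lambda>_. 0))"
      by (simp add: init_def M_def)
    then show ?thesis
      using steps[of Start t "(0, enc n) # replicate (k - 1) (0, \<lambda>_. 0)"] assms(2) that
      by (simp add: run_def code_Halt M_def)
  qed
  then show ?thesis by (intro exI[of _ M]) (simp add: wf)
qed

text \<open>The state of an automaton with transition function \<open>\<eta>\<close> and start state 0 after it has read the
  \<open>i\<close> lowest bits of \<open>n\<close>, beginning with the least significant one.\<close>

fun scan_state :: "(nat \<Rightarrow> bool \<Rightarrow> nat) \<Rightarrow> nat \<Rightarrow> nat \<Rightarrow> nat" where
  "scan_state \<eta> n 0 = 0"
| "scan_state \<eta> n (Suc i) = \<eta> (scan_state \<eta> n i) (bit n i)"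

lemma control_run:
  assumes "1 < N" "registers (prog (scan_state \<eta> n (floorlog 2 n))) \<subseteq> {..<N}"
    and "runs (prog (scan_state \<eta> n (floorlog 2 n))) (\<lambda>r. if r = 0 then floorlog 2 n else 0) T \<sigma>"
    and "\<sigma> 1 \<le> 2"
  shows "\<exists>t\<le>floorlog 2 n + T + 5. \<exists>inp p \<sigma>'.
    (control_step (trans_fun N \<eta> prog) ^^ t) (Start, (0, enc n) # replicate (N + 1) (0, \<lambda>_. 0))
      = (Halt, mk_tapes N inp (p, enc (\<sigma> 1)) \<sigma>')"
proof -
  let ?step = "control_step (trans_fun N \<eta> prog)" and ?l = "floorlog 2 n"
  define P where "P = prog (scan_state \<eta> n ?l)"
  define out :: tape where "out = (0, \<lambda>_. 0)"
  define \<rho> where "\<rho> l r = (if r = 0 then l else 0 :: nat)" for l r :: nat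
  let ?init = "(Start, (0, enc n) # replicate (N + 1) (0, \<lambda>_. 0))"
  have "map2 act (replicate N (0, \<lambda>_. 0)) (replicate N (1, 0)) = replicate N (register_tape 0)"
    by (rule nth_equalityI) (auto simp: register_tape_def)
  moreover have "map (\<lambda>r. register_tape (\<rho> 0 r)) [0..<N] = replicate N (register_tape 0)"
    by (rule nth_equalityI) (auto simp: \<rho>_def)
  ultimately have start: "?step ?init = (Scan 0, mk_tapes N (0, enc n) out (\<rho> 0))"
    by (simp add: control_step_def mk_tapes_def scanned_def out_def fun_upd_idem)
  have scan: "i \<le> ?l \<Longrightarrow> (?step ^^ i) (Scan 0, mk_tapes N (0, enc n) out (\<rho> 0))
      = (Scan (scan_state \<eta> n i), mk_tapes N (int i, enc n) out (\<rho> i))" for i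
  proof (induction i)
    case (Suc i)
    have "(\<rho> i)(0 := Suc (\<rho> i 0)) = \<rho> (Suc i)" by (auto simp: \<rho>_def)
    then show ?case
      using Suc control_step_Scan[of N "int i" n \<eta> prog "scan_state \<eta> n i" out "\<rho> i"] assms(1)
      by (simp add: add.commute)
  qed simp
  have load: "?step (Scan (scan_state \<eta> n ?l), mk_tapes N (int ?l, enc n) out (\<rho> ?l))
      = (Run P, mk_tapes N (int ?l, enc n) out (\<rho> ?l))"
    using scanned_mk_tapes(1)[of N "(int ?l, enc n)" out "\<rho> ?l"]
    by (simp add: control_step_def map2_act_stay P_def enc_def)
  have exec: "\<exists>t'\<le>t. (?step ^^ t') (Run K, mk_tapes N inp out \<rho>') = (Run [], mk_tapes N inp out \<sigma>)"
    if "(pstep ^^ t) (K, \<rho>') = ([], \<sigma>)" "K \<in> continuations P []" for t K \<rho>' inp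
    using that
  proof (induction t arbitrary: K \<rho>')
    case 0
    then show ?case by (intro exI[of _ 0]) simp
  next
    case (Suc t)
    show ?case
    proof (cases "K = []")
      case True
      have "(pstep ^^ t') ([], \<rho>') = ([], \<rho>')" for t' by (induction t') auto
      then show ?thesis using Suc.prems(1) True by (intro exI[of _ 0]) simp
    next
      case False
      obtain K1 \<rho>1 where p: "pstep (K, \<rho>') = (K1, \<rho>1)" by fastforce
      have "K1 \<in> continuations P []"
        using continuations_closed[OF Suc.prems(2), of \<rho>'] p False by simp
      moreover have "(pstep ^^ t) (K1, \<rho>1) = ([], \<sigma>)"
        using Suc.prems(1) p by (simp add: funpow_Suc_right del: funpow.simps)
      ultimately obtain t' where t': "t' \<le> t"
        "(?step ^^ t') (Run K1, mk_tapes N inp out \<rho>1) = (Run [], mk_tapes N inp out \<sigma>)"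
        using Suc.IH by blast
      have "registers K \<subseteq> {..<N}"
        using registers_continuations[OF Suc.prems(2)] assms(2) by (auto simp: P_def)
      from control_step_Run[OF False this p] t'
      have "(?step ^^ Suc t') (Run K, mk_tapes N inp out \<rho>') = (Run [], mk_tapes N inp out \<sigma>)"
        by (simp add: funpow_Suc_right del: funpow.simps)
      then show ?thesis using t'(1) by (intro exI[of _ "Suc t'"]) simp
    qed
  qed
  obtain t1 where t1: "t1 \<le> T" "(pstep ^^ t1) (P, \<rho> ?l) = ([], \<sigma>)"
    using assms(3) unfolding runs_def P_def \<rho>_def by (metis append_Nil2)
  obtain t2 where t2: "t2 \<le> t1" "(?step ^^ t2) (Run P, mk_tapes N (int ?l, enc n) out (\<rho> ?l))
      = (Run [], mk_tapes N (int ?l, enc n) out \<sigma>)"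
    using exec[OF t1(2)] self_in_continuations[of P "[]"] by auto
  obtain t3 inp p \<sigma>' where t3: "t3 \<le> 3" "(?step ^^ t3) (Run [], mk_tapes N (int ?l, enc n) out \<sigma>)
      = (Halt, mk_tapes N inp (p, enc (\<sigma> 1)) \<sigma>')"
    using control_step_output[of N \<sigma>, OF assms(1,4), of \<eta> prog "(int ?l, enc n)"] unfolding out_def by blast
  have "(?step ^^ (t3 + (t2 + (Suc 0 + (?l + Suc 0))))) ?init = (Halt, mk_tapes N inp (p, enc (\<sigma> 1)) \<sigma>')"
    by (simp only: funpow_add funpow.simps comp_apply id_apply start scan[OF order_refl] load
      t2(2) t3(2))
  then show ?thesis using t1(1) t2(1) t3(1)
    by (intro exI[of _ "t3 + (t2 + (Suc 0 + (?l + Suc 0)))"] conjI) (simp, blast)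
qed

lemma outputs_within_mono:
  assumes "outputs_within M n t m" "t \<le> t'"
  shows "outputs_within M n t' m"
proof -
  obtain ts where r: "run M n t = (states M, ts)"
    using assms(1) by (auto simp: outputs_within_def split: prod.splits)
  have "(step M ^^ d) (states M, ts) = (states M, ts)" for d
    by (induction d) (auto simp: step_def)
  moreover have "run M n t' = (step M ^^ (t' - t)) (run M n t)"
    using assms(2) by (simp add: run_def funpow_add[symmetric, THEN fun_cong, unfolded comp_apply])
  ultimately have "run M n t' = run M n t" using r by simp
  then show ?thesis using assms(1) by (simp add: outputs_within_def)
qed

text \<open>The value depends on the length of \<open>n\<close>, through a function in the second Grzegorczyk class, and on
  what a finite automaton finds out about \<open>n\<close>.\<close>

theorem scanned_grz_poly_time:
  assumes "0 < A" "\<And>a b. a < A \<Longrightarrow> \<eta> a b < A"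
    and F: "\<And>a. a < A \<Longrightarrow> grzegorczyk 2 1 (F a)" "\<And>a l. F a [l] \<le> 2"
  shows "(\<lambda>n. F (scan_state \<eta> n (floorlog 2 n)) [floorlog 2 n]) \<in> poly_time_in_length"
proof -
  have "\<exists>P p. \<forall>l. runs P (\<lambda>r. if r = 0 then l else 0) (poly p l)
      ((\<lambda>r. if r = 0 then l else 0)(1 := F a [l]))" if a: "a < A" for a
  proof -
    obtain P p where P: "\<And>\<sigma> M. (\<forall>r\<ge>2. \<sigma> r = 0) \<Longrightarrow> \<sigma> 1 = 0 \<Longrightarrow> (\<forall>a\<in>set [0]. \<sigma> a \<le> M) \<Longrightarrow>
      runs P \<sigma> (poly p M) (\<sigma>(1 := F a (map \<sigma> [0])))"
      by (rule compilableE[OF compilable_grz[OF F(1)[OF a]], of "[0]" 2 1]) auto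
    have "runs P (\<lambda>r. if r = 0 then l else 0) (poly p l)
      ((\<lambda>r. if r = 0 then l else 0)(1 := F a [l]))" for l
      using P[of "\<lambda>r. if r = 0 then l else 0" l] by simp
    then show ?thesis by blast
  qed
  then obtain prog p where prog: "\<And>a l. a < A \<Longrightarrow> runs (prog a) (\<lambda>r. if r = 0 then l else 0)
      (poly (p a) l) ((\<lambda>r. if r = 0 then l else 0)(1 := F a [l]))"
    by metis
  obtain N where N: "1 < N" "(\<Union>a<A. registers (prog a)) \<subseteq> {..<N}"
  proof -
    have "finite (\<Union>a<A. registers (prog a))" by (auto simp: finite_registers)
    then obtain m where "(\<Union>a<A. registers (prog a)) \<subseteq> {..<m}"
      using finite_nat_iff_bounded by blast
    then show thesis by (intro that[of "m + 2"]) auto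
  qed
  define Ks where "Ks = (\<Union>a<A. continuations (prog a) [])"
  define S where "S = {Start, Out1, Out2} \<union> Scan ` {..<A} \<union> Run ` Ks"
  have regs: "registers K \<subseteq> {..<N}" if "K \<in> Ks" for K
    using that registers_continuations N(2) by (fastforce simp: Ks_def)
  have Ks_step: "fst (pstep (K, \<sigma>)) \<in> Ks" if "K \<in> Ks" for K \<sigma>
    using that continuations_closed[of K _ "[]" \<sigma>] by (fastforce simp: Ks_def)
  let ?tr = "trans_fun N \<eta> prog"
  have "finite S" by (auto simp: S_def Ks_def finite_continuations)
  moreover have "Start \<in> S" "Halt \<notin> S" by (auto simp: S_def)
  moreover have "2 \<le> N + 2" by simp
  moreover have "fst (?tr q xs) \<in> insert Halt S" if "q \<in> S" for q xs
  proof -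
    have "fst (?tr (Run K) xs) \<in> insert Halt S" if "K \<in> Ks" for K
      using Ks_step[OF that, of "\<lambda>_. 0"] Ks_step[OF that, of "\<lambda>_. 1"]
      by (cases K rule: registers.cases) (auto simp: S_def)
    moreover have "prog a \<in> Ks" if "a < A" for a
      using self_in_continuations[of "prog a" "[]"] that by (auto simp: Ks_def)
    ultimately show ?thesis using that assms(1,2) by (auto simp: S_def)
  qed
  moreover have "length (snd (?tr q xs)) = N + 2 \<and> set (snd (?tr q xs)) \<subseteq> {..<3} \<times> {- 1, 0, 1}"
    if q: "q \<in> S" and len: "length xs = N + 2" and sub: "set xs \<subseteq> {..<3}" for q xs
  proof -
    define ok :: "(nat \<times> int) list \<Rightarrow> bool"
      where "ok as \<longleftrightarrow> length as = N + 2 \<and> set as \<subseteq> {..<3} \<times> {- 1, 0, 1}" for as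
    have nth: "xs ! i < 3" if "i < N + 2" for i using that len sub nth_mem by (metis lessThan_iff subsetD)
    have stay: "ok (stay xs)" using sub len by (auto simp: ok_def stay_def)
    have upd: "ok (as[i := (x, d)])" if "ok as" "x < 3" "d = - 1 \<or> d = 0 \<or> d = 1" for as i x d
      using set_update_subset_insert[of as i "(x, d)"] that by (auto simp: ok_def)
    have "ok (snd (?tr (Run K) xs))" if "K \<in> Ks" for K
      using regs[OF that] stay nth[of 3] nth[of "_ + 2"] N(1)
      by (cases K rule: registers.cases) (auto intro!: upd)
    moreover have "ok ((xs ! 0, 0) # (xs ! 1, 0) # replicate N (1, 0))"
      using nth[of 0] nth[of 1] by (auto simp: ok_def)
    ultimately have "ok (snd (?tr q xs))"
      using q stay nth[of 0] nth[of 2] nth[of 3] N(1) by (auto simp: S_def intro!: upd)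
    then show ?thesis by (simp add: ok_def)
  qed
  moreover have "?tr Halt xs = (Halt, stay xs)" for xs by simp
  ultimately have "\<exists>M. wf_tm M \<and> (\<forall>n t ts. (control_step ?tr ^^ t)
      (Start, (0, enc n) # replicate (N + 2 - 1) (0, \<lambda>_. 0)) = (Halt, ts) \<longrightarrow> run M n t = (states M, ts))"
    by (rule machine_of_control[of S "N + 2" ?tr])
  then obtain M where M: "wf_tm M" "\<And>n t ts. (control_step ?tr ^^ t)
      (Start, (0, enc n) # replicate (N + 1) (0, \<lambda>_. 0)) = (Halt, ts) \<Longrightarrow> run M n t = (states M, ts)"
    by auto
  define b where "b = [:5, 1:] + (\<Sum>a<A. p a)"
  have "outputs_within M n (poly b (floorlog 2 n))
    (F (scan_state \<eta> n (floorlog 2 n)) [floorlog 2 n])" for n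
  proof -
    let ?l = "floorlog 2 n"
    define a where "a = scan_state \<eta> n ?l"
    have a: "a < A"
    proof -
      have "scan_state \<eta> n i < A" for i by (induction i) (use assms(1,2) in auto)
      then show ?thesis by (simp add: a_def)
    qed
    have "registers (prog a) \<subseteq> {..<N}" using N(2) a by blast
    from control_run[OF N(1), of prog \<eta> n, folded a_def, OF this prog[OF a]] F(2)[of a ?l]
    obtain t inp pos \<sigma>' where t: "t \<le> ?l + poly (p a) ?l + 5"
      "(control_step ?tr ^^ t) (Start, (0, enc n) # replicate (N + 1) (0, \<lambda>_. 0))
        = (Halt, mk_tapes N inp (pos, enc (F a [?l])) \<sigma>')"
      unfolding fun_upd_same by blast
    have "run M n t = (states M, mk_tapes N inp (pos, enc (F a [?l])) \<sigma>')"
      using M(2) t(2) by simp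
    then have "outputs_within M n t (F a [?l])"
      using nth_mk_tapes(2) by (simp add: outputs_within_def)
    moreover have "poly (p a) ?l \<le> (\<Sum>a<A. poly (p a) ?l)" using a by (intro member_le_sum) auto
    then have "t \<le> poly b ?l" using t(1) by (simp add: b_def poly_sum)
    ultimately show ?thesis unfolding a_def by (rule outputs_within_mono)
  qed
  then show ?thesis unfolding poly_time_in_length_def using M(1) by blast
qed

section \<open>Inclusions between the machine classes\<close>

lemma floorlog_le: "floorlog 2 n \<le> n"
  by (rule floorlog_leI) (auto simp: less_exp)

lemma poly_time_in_length_subset_argument: "poly_time_in_length \<subseteq> poly_time_in_argument"
  unfolding poly_time_in_length_def poly_time_in_argument_def
  using outputs_within_mono[OF _ poly_nat_mono[OF floorlog_le]] by blast

text \<open>The factor \<open>l ^ k\<close> serves the induction on \<open>p\<close> only.\<close>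

lemma poly_times_power_le_exp: "\<exists>C. \<forall>l. l ^ k * poly (p :: nat poly) l \<le> C * 2 ^ l"
proof (induction p arbitrary: k)
  case (pCons a p)
  have pow: "l ^ k \<le> k ^ k * 2 ^ l" for l :: nat
  proof (cases "k \<le> l")
    case True
    have "(real l / real k) ^ k \<le> real (l choose k)"
      using binomial_ge_n_over_k_pow_k[OF True] by simp
    also have "\<dots> \<le> 2 ^ l" using binomial_le_pow2[of l k] by (metis of_nat_le_iff of_nat_numeral of_nat_power)
    finally have "real l ^ k \<le> real k ^ k * 2 ^ l"
      by (cases "k = 0") (auto simp: power_divide field_simps)
    then have "real (l ^ k) \<le> real (k ^ k * 2 ^ l)" by simp
    then show ?thesis by (simp only: of_nat_le_iff)
  next
    case False
    then have "l ^ k \<le> k ^ k * 1" by (simp add: power_mono)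
    also have "\<dots> \<le> k ^ k * 2 ^ l" by (intro mult_left_mono) auto
    finally show ?thesis .
  qed
  obtain C where C: "\<And>l. l ^ Suc k * poly p l \<le> C * 2 ^ l" using pCons.IH by blast
  have "l ^ k * poly (pCons a p) l \<le> (a * k ^ k + C) * 2 ^ l" for l
    using add_mono[OF mult_left_mono[OF pow[of l], of a] C[of l]] by (simp add: algebra_simps)
  then show ?case by blast
qed simp

lemma poly_time_in_length_subset_linear_space: "poly_time_in_length \<subseteq> linear_space_in_argument"
proof
  fix f assume "f \<in> poly_time_in_length"
  then obtain M p where M: "wf_tm M" "\<And>n. outputs_within M n (poly p (floorlog 2 n)) (f n)"
    unfolding poly_time_in_length_def by blast
  obtain C where C: "\<And>l. poly p l \<le> C * 2 ^ l"
    using poly_times_power_le_exp[of 0 p] by auto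
  have "space_used M n (poly p (floorlog 2 n)) \<le> (tapes M * (2 * C + 1)) * n + tapes M * (2 * C + 1)" for n
  proof -
    let ?t = "poly p (floorlog 2 n)"
    have "space_used M n ?t \<le> (\<Sum>j<tapes M. Suc ?t)"
      unfolding space_used_def by (intro sum_mono order_trans[OF card_image_le]) auto
    also have "\<dots> = tapes M * Suc ?t" by simp
    also have "\<dots> \<le> tapes M * ((2 * C + 1) * (n + 1))"
    proof (intro mult_left_mono)
      have "2 ^ floorlog 2 n \<le> 2 * n + 1"
      proof (cases "n = 0")
        case False
        then have "2 ^ (floorlog 2 n - 1) \<le> n" using floorlog_bounds[of n 2] by simp
        moreover have "floorlog 2 n = Suc (floorlog 2 n - 1)"
          using False by (simp add: floorlog_def)
        ultimately show ?thesis by (metis mult_le_mono2 power_Suc trans_le_add1)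
      qed (simp add: floorlog_def)
      then have "?t \<le> C * (2 * n + 1)" using C[of "floorlog 2 n"] by (meson le_trans mult_le_mono2)
      then show "Suc ?t \<le> (2 * C + 1) * (n + 1)" by (simp add: algebra_simps)
    qed simp
    finally show ?thesis by (simp add: algebra_simps)
  qed
  then show "f \<in> linear_space_in_argument"
    unfolding linear_space_in_argument_def using M by blast
qed

section \<open>Digit sequences in the complexity classes\<close>

lemma grz_eventually_const:
  assumes "0 < m" "\<And>n. K \<le> n \<Longrightarrow> f n = c"
  shows "grzegorczyk m 1 (\<lambda>xs. f (xs ! 0))"
  using assms(2)
proof (induction K arbitrary: f)
  case 0
  then show ?case using grz_const[of m 1 c] by simp
next
  case (Suc K)
  have "grzegorczyk m 1 (\<lambda>xs. f (Suc (xs ! 0)))" using Suc.IH[of "\<lambda>n. f (Suc n)"] Suc.prems by simp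
  from grz_comp1[OF this grz_pred[OF grzegorczyk.proj[of 0 1]]]
  have "grzegorczyk m 1 (\<lambda>xs. f (Suc (xs ! 0 - 1)))" by simp
  then have "grzegorczyk m 1 (\<lambda>xs. if xs ! 0 = 0 then f 0 else f (Suc (xs ! 0 - 1)))"
    using assms(1) by (intro grz_if grz_const grzegorczyk.proj) auto
  moreover have "(if x = 0 then f 0 else f (Suc (x - 1))) = f x" for x by (cases x) auto
  ultimately show ?case by simp
qed

theorem grzegorczyk_reals_no_copy:
  assumes "2 \<le> n"
  shows "\<not> has_computable_copy (real_struct (reals_of (unary_grzegorczyk n)))"
proof (rule no_computable_copy[of "\<lambda>i. i"])
  show "strict_mono (\<lambda>i :: nat. i)" by (simp add: strict_mono_def)
  show "approximable 1 (\<lambda>xs. Some (xs ! 0))" by (rule approximable_proj) simp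
  show "f \<in> unary_grzegorczyk n" if "\<And>i. K \<le> i \<Longrightarrow> f i = 1" for f and K :: nat
    using grz_eventually_const[of n K f 1] that assms
    unfolding unary_grzegorczyk_def by (intro CollectI exI[of _ "\<lambda>xs. f (xs ! 0)"]) auto
  show "spread (\<lambda>i. i) (\<lambda>i. F [i]) \<in> unary_grzegorczyk n" if "grzegorczyk 2 1 F" for F
  proof -
    have "spread (\<lambda>i. i) (\<lambda>i. F [i]) = (\<lambda>i. F [i])"
      using spread_pos[of "\<lambda>i. i"] by (auto simp: fun_eq_iff)
    then show ?thesis
      using grz_mono[OF that assms] unfolding unary_grzegorczyk_def by auto
  qed
qed

lemma floorlog_bounds_2: "n < 2 ^ floorlog 2 n" "n \<noteq> 0 \<Longrightarrow> 2 ^ (floorlog 2 n - 1) \<le> n"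
  using floorlog_bounds[of n 2] by (cases "n = 0"; simp)+

text \<open>The automaton is a shift register for the last \<open>B\<close> bits read. It contains a short input completely,
  shifted by an amount known from the length.\<close>

lemma finite_support_poly_time:
  assumes "\<And>n. f n \<le> 2" "\<And>n. K \<le> n \<Longrightarrow> f n = 1"
  shows "f \<in> poly_time_in_length"
proof -
  define B where "B = Suc K"
  define \<eta> where "\<eta> a b = a div 2 + of_bool b * 2 ^ K" for a :: nat and b
  define F where "F a xs = (if xs ! 0 \<le> B then f (a div 2 ^ (B - xs ! 0)) else 1)"
    for a and xs :: "nat list"
  have scan: "i \<le> B \<Longrightarrow> scan_state \<eta> n i = take_bit i n * 2 ^ (B - i)" for n i
  proof (induction i)
    case (Suc i)
    then have "B - i = Suc (B - Suc i)" by simp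
    then have "scan_state \<eta> n i = take_bit i n * 2 ^ (B - Suc i) * 2" using Suc by simp
    then have "scan_state \<eta> n (Suc i) = take_bit i n * 2 ^ (B - Suc i) + of_bool (bit n i) * 2 ^ K"
      unfolding scan_state.simps \<eta>_def[of "scan_state \<eta> n i"] by simp
    also have "(2 :: nat) ^ K = 2 ^ i * 2 ^ (B - Suc i)"
      using Suc.prems by (simp add: B_def flip: power_add)
    finally show ?case by (simp add: take_bit_Suc_from_most algebra_simps)
  qed simp
  have "(\<lambda>n. F (scan_state \<eta> n (floorlog 2 n)) [floorlog 2 n]) \<in> poly_time_in_length"
  proof (rule scanned_grz_poly_time[of "2 ^ B"])
    show "\<eta> a b < 2 ^ B" if "a < 2 ^ B" for a b
      using that by (auto simp: \<eta>_def B_def)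
    show "grzegorczyk 2 1 (F a)" for a
      using grz_eventually_const[of 2 "Suc B" "\<lambda>l. if l \<le> B then f (a div 2 ^ (B - l)) else 1" 1]
      by (simp add: F_def[abs_def])
    show "F a [l] \<le> 2" for a l using assms(1) by (simp add: F_def)
  qed simp
  moreover have "F (scan_state \<eta> n (floorlog 2 n)) [floorlog 2 n] = f n" for n
  proof (cases "floorlog 2 n \<le> B")
    case True
    then show ?thesis
      using floorlog_bounds_2(1)[of n] by (simp add: F_def scan take_bit_nat_eq_self)
  next
    case False
    then have "n \<noteq> 0" by (cases "n = 0") (auto simp: floorlog_def)
    have "K < 2 ^ K" by (rule less_exp)
    also have "(2 :: nat) ^ K \<le> 2 ^ (floorlog 2 n - 1)"
      using False by (intro power_increasing) (auto simp: B_def)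
    also have "\<dots> \<le> n" using \<open>n \<noteq> 0\<close> by (rule floorlog_bounds_2)
    finally show ?thesis using False assms(2)[of n] by (simp add: F_def)
  qed
  ultimately show ?thesis by simp
qed

lemma spread_powers_poly_time:
  assumes "grzegorczyk 2 1 F" "\<And>n. F [n] \<le> 2"
  shows "spread (\<lambda>i. 2 ^ i) (\<lambda>i. F [i]) \<in> poly_time_in_length"
proof -
  \<comment> \<open>The state is 0 before the first 1, 1 just after it, and 2 later on.\<close>
  define \<eta> :: "nat \<Rightarrow> bool \<Rightarrow> nat" where "\<eta> a b = (if a = 0 then if b then 1 else 0 else 2)" for a b
  define G where "G a xs = (if a = 1 then F [xs ! 0 - 1] else 1)" for a :: nat and xs :: "nat list"
  have inj: "inj (\<lambda>i. 2 ^ i :: nat)" by (simp add: inj_on_def)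
  have scan: "scan_state \<eta> n i = (if take_bit i n = 0 then 0
      else if take_bit i n = 2 ^ (i - 1) then 1 else 2)" for n i
  proof (induction i)
    case (Suc i)
    have "take_bit i n < 2 ^ i" by simp
    moreover have "take_bit i n \<noteq> 2 ^ i" using \<open>take_bit i n < 2 ^ i\<close> by linarith
    ultimately show ?case using Suc by (auto simp: \<eta>_def take_bit_Suc_from_most)
  qed simp
  have "(\<lambda>n. G (scan_state \<eta> n (floorlog 2 n)) [floorlog 2 n]) \<in> poly_time_in_length"
  proof (rule scanned_grz_poly_time[of 3])
    show "\<eta> a b < 3" for a b by (simp add: \<eta>_def)
    show "grzegorczyk 2 1 (G a)" for a
      using grz_comp1[OF assms(1) grz_pred[OF grzegorczyk.proj[of 0 1 2]]] grz_const[of 2 1 1]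
      by (cases "a = 1") (simp_all add: G_def[abs_def])
    show "G a [l] \<le> 2" for a l using assms(2) by (simp add: G_def)
  qed simp
  moreover have "G (scan_state \<eta> n (floorlog 2 n)) [floorlog 2 n] = spread (\<lambda>i. 2 ^ i) (\<lambda>i. F [i]) n" for n
  proof -
    let ?l = "floorlog 2 n"
    have n: "take_bit ?l n = n" using floorlog_bounds_2(1) by (simp add: take_bit_nat_eq_self)
    show ?thesis
    proof (cases "n \<noteq> 0 \<and> n = 2 ^ (?l - 1)")
      case True
      then have "spread (\<lambda>i. 2 ^ i) (\<lambda>i. F [i]) n = F [?l - 1]"
        using spread_pos[OF inj, of "\<lambda>i. F [i]" "?l - 1"] by metis
      then show ?thesis using True n by (simp add: G_def scan)
    next
      case False
      have "n \<noteq> 2 ^ i" for i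
      proof
        assume "n = 2 ^ i"
        moreover have "floorlog 2 (2 ^ i) = Suc i" by (simp add: floorlog_def)
        ultimately show False using False by simp
      qed
      then have "spread (\<lambda>i. 2 ^ i) (\<lambda>i. F [i]) n = 1" by (auto simp: spread_def)
      then show ?thesis using False n by (auto simp: G_def scan)
    qed
  qed
  ultimately show ?thesis by simp
qed

lemma approximable_power_2: "approximable 1 (\<lambda>xs. Some (2 ^ (xs ! 0)))"
proof -
  have "approximable (0 + 2) (\<lambda>xs. Some (xs ! 1 + xs ! 1))"
    by (intro approximable_grz grz_add grzegorczyk.proj) auto
  from approximable_prec[OF approximable_const[of 0 1] this]
  have "approximable 1 (opt_prec (\<lambda>xs. Some 1) (\<lambda>xs. Some (xs ! 1 + xs ! 1)))" by simp
  then show ?thesis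
  proof (rule approximable_ext)
    have "opt_prec (\<lambda>xs. Some 1) (\<lambda>xs. Some (xs ! 1 + xs ! 1)) [n] = Some (2 ^ n)" for n
      by (induction n) auto
    then show "Some (2 ^ (xs ! 0)) = opt_prec (\<lambda>xs. Some 1) (\<lambda>xs. Some (xs ! 1 + xs ! 1)) xs"
      if "length xs = 1" for xs
      using that by (auto simp: length_Suc_conv)
  qed
qed

theorem poly_time_reals_no_copy:
  assumes "poly_time_in_length \<subseteq> C"
  shows "\<not> has_computable_copy (real_struct (reals_of C))"
proof (rule no_computable_copy[OF _ approximable_power_2])
  show "strict_mono (\<lambda>i. 2 ^ i :: nat)" by (simp add: strict_mono_def)
  show "f \<in> C" if "\<And>n. f n \<le> 2" "\<And>n. K \<le> n \<Longrightarrow> f n = 1" for f K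
    using finite_support_poly_time[of f K, OF that] assms by blast
  show "spread (\<lambda>i. 2 ^ i) (\<lambda>n. F [n]) \<in> C" if "grzegorczyk 2 1 F" "\<And>n. F [n] \<le> 2" for F
    using spread_powers_poly_time[OF that] assms by blast
qed

theorem corollary1:
  fixes R :: "real set"
  assumes "R = P_numbers \<or> R = SP_numbers \<or> (\<exists>n\<ge>2. R = E_numbers n)"
  shows "\<not> has_computable_copy (real_struct R)"
  using assms
proof (elim disjE exE conjE)
  show ?thesis if "R = P_numbers"
    unfolding that P_numbers_def
    by (rule poly_time_reals_no_copy[OF poly_time_in_length_subset_argument])
  show ?thesis if "R = SP_numbers"
    unfolding that SP_numbers_def by (rule poly_time_reals_no_copy) simp
  show ?thesis if "n \<ge> 2" "R = E_numbers n" for n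
    using poly_time_reals_no_copy[OF poly_time_in_length_subset_linear_space]
      grzegorczyk_reals_no_copy[OF that(1)]
    unfolding that(2) E_numbers_def by auto
qed

end
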